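(* Let $n\ge2$, let $k$ be a field, and let $D(I)=(x_1,\dots,x_n)^{n-1}_{\mathrm{sq.fr.}}\subseteq k[x_1,\dots,x_n]$ be the ideal generated by all square-free monomials of degree $n-1$. Let $T$ be a spanning tree of the complete graph $K_n$ and let $P=(m_1,\dots,m_n)$ be the ideal constructed from $T$. Then $P$ is a polarization of $D(I)$, and the linear relations between the generators of $P$ are precisely the edges of $T$: there is a linear relation between $m_i$ and $m_j$ if and only if $(i,j)$ is an edge of $T$.
   Context: Polarization: Let $J$ be a monomial ideal in $S=k[x_1,\dots,x_n]$. A polarization of $J$ is a square-free monomial ideal $\widetilde J$ in a polynomial ring $\widetilde S=k[x_i^{(j)}]$ with finitely many copies $x_i^{(j)}$ of each variable $x_i$, such that the differences $x_i^{(j_0)}-x_i^{(j)}$ between a fixed copy and each other copy of $x_i$, for all $i$, form a regular $\widetilde S/\widetilde J$-sequence and substituting $x_i^{(j)}\mapsto x_i$ carries $\widetilde J$ to $J$. Construction of $P$: let $T$ be a spanning tree of $K_n$ (vertex set $\{1,\dots,n\}$) with edges labeled $e_1,\dots,e_{n-1}$. Removing the edge $e_i=(v_i,w_i)$ disconnects $T$ into two components; label every vertex in the component containing $v_i$ by $w_i^{(i)}$ and every vertex in the component containing $w_i$ by $v_i^{(i)}$. For each vertex $v$ put $m_v=\prod x_j^{(i)}$, the product over all labels $j^{(i)}$ of $v$, and $P=(m_1,\dots,m_n)$, in the polynomial ring on the variables $x_j^{(i)}$ with $j$ an endpoint of $e_i$. Linear relation: two distinct generators of the same degree $e$ have a linear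 relation between them if their lcm has degree $e+1$. *)

theory Defs
  imports "HOL-Library.Poly_Mapping" "HOL-Algebra.QuotRing"
begin

section \<open>Polynomial rings over a set of variables\<close>

text \<open>Monomials are exponent vectors, and a polynomial maps each monomial to its coefficient.
  Addition of exponent vectors is multiplication of monomials.\<close>

type_synonym 'x monomial = "'x \<Rightarrow>\<^sub>0 nat"
type_synonym ('x, 'k) mpoly = "'x monomial \<Rightarrow>\<^sub>0 'k"

definition mono :: "'x monomial \<Rightarrow> ('x, 'k::comm_ring_1) mpoly" where
  "mono s = Poly_Mapping.single s 1"

definition var :: "'x \<Rightarrow> ('x, 'k::comm_ring_1) mpoly" where
  "var x = mono (Poly_Mapping.single x 1)"

definition mpoly_ring :: "'x set \<Rightarrow> ('x, 'k::comm_ring_1) mpoly ring" where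
  "mpoly_ring X =
    \<lparr>carrier = {p. \<forall>s \<in> Poly_Mapping.keys p. Poly_Mapping.keys s \<subseteq> X},
     mult = (*), one = 1, zero = 0, add = (+)\<rparr>"

definition subst_vars ::
    "('x \<Rightarrow> ('y, 'k::comm_ring_1) mpoly) \<Rightarrow> ('x, 'k) mpoly \<Rightarrow> ('y, 'k) mpoly" where
  "subst_vars f p =
    (\<Sum>s\<in>Poly_Mapping.keys p. Poly_Mapping.single 0 (Poly_Mapping.lookup p s) *
      (\<Prod>x\<in>Poly_Mapping.keys s. f x ^ Poly_Mapping.lookup s x))"

definition mon_deg :: "'x monomial \<Rightarrow> nat" where
  "mon_deg s = (\<Sum>x\<in>Poly_Mapping.keys s. Poly_Mapping.lookup s x)"

definition mon_lcm :: "'x monomial \<Rightarrow> 'x monomial \<Rightarrow> 'x monomial" where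
  "mon_lcm s t = (\<Sum>x\<in>Poly_Mapping.keys s \<union> Poly_Mapping.keys t.
    Poly_Mapping.single x (max (Poly_Mapping.lookup s x) (Poly_Mapping.lookup t x)))"

definition sqfree :: "'x monomial \<Rightarrow> bool" where
  "sqfree s \<longleftrightarrow> (\<forall>x. Poly_Mapping.lookup s x \<le> 1)"

section \<open>Monomial ideals and polarizations\<close>

definition ideal_of :: "'x set \<Rightarrow> 'x monomial set \<Rightarrow> ('x, 'k::comm_ring_1) mpoly set" where
  "ideal_of X M = Idl\<^bsub>mpoly_ring X\<^esub> (mono ` M)"

definition monomial_ideal :: "'x set \<Rightarrow> ('x, 'k::comm_ring_1) mpoly set \<Rightarrow> bool" where
  "monomial_ideal X J \<longleftrightarrow>
    (\<exists>M. (\<forall>s\<in>M. Poly_Mapping.keys s \<subseteq> X) \<and> J = ideal_of X M)"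

definition sqfree_monomial_ideal :: "'x set \<Rightarrow> ('x, 'k::comm_ring_1) mpoly set \<Rightarrow> bool" where
  "sqfree_monomial_ideal X J \<longleftrightarrow>
    (\<exists>M. (\<forall>s\<in>M. Poly_Mapping.keys s \<subseteq> X \<and> sqfree s) \<and> J = ideal_of X M)"

definition regular_sequence :: "('a, 'b) ring_scheme \<Rightarrow> 'a list \<Rightarrow> bool" where
  "regular_sequence R fs \<longleftrightarrow>
    set fs \<subseteq> carrier R \<and>
    (\<forall>i < length fs. \<forall>a \<in> carrier R.
      fs ! i \<otimes>\<^bsub>R\<^esub> a \<in> Idl\<^bsub>R\<^esub> (set (take i fs)) \<longrightarrow> a \<in> Idl\<^bsub>R\<^esub> (set (take i fs))) \<and>
    Idl\<^bsub>R\<^esub> (set fs) \<noteq> carrier R"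

text \<open>The variable \<open>x\<^sub>i\<^sup>(\<^sup>j\<^sup>)\<close> is the pair \<open>(i, j)\<close>, and \<open>C i\<close> is the set of indices of the copies of
  \<open>x\<^sub>i\<close>, so that \<open>Sigma V C\<close> is the set of all variables of the larger ring. The differences are
  homogeneous of positive degree, so neither the order in which they are listed nor the choice
  \<open>c i\<close> of the fixed copy of \<open>x\<^sub>i\<close> matters; the definition requires regularity for all of them.\<close>

definition polarization ::
    "'v set \<Rightarrow> ('v \<Rightarrow> 'c set) \<Rightarrow> ('v \<times> 'c, 'k::field) mpoly set \<Rightarrow> ('v, 'k) mpoly set \<Rightarrow> bool" where
  "polarization V C J' J \<longleftrightarrow>
    finite V \<and> (\<forall>i\<in>V. finite (C i) \<and> C i \<noteq> {}) \<and>
    monomial_ideal V J \<and> sqfree_monomial_ideal (Sigma V C) J' \<and>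
    (\<forall>c ds. (\<forall>i\<in>V. c i \<in> C i) \<and> distinct ds \<and>
        set ds = {var (i, c i) - var (i, j) | i j. i \<in> V \<and> j \<in> C i \<and> j \<noteq> c i} \<longrightarrow>
      regular_sequence (mpoly_ring (Sigma V C) Quot J')
        (map (\<lambda>d. J' +>\<^bsub>mpoly_ring (Sigma V C)\<^esub> d) ds)) \<and>
    subst_vars (\<lambda>(i, j). var i) ` J' = J"

definition linear_relation :: "'x monomial \<Rightarrow> 'x monomial \<Rightarrow> bool" where
  "linear_relation s t \<longleftrightarrow>
    s \<noteq> t \<and> mon_deg s = mon_deg t \<and> mon_deg (mon_lcm s t) = mon_deg s + 1"

definition sqfree_power :: "'x set \<Rightarrow> nat \<Rightarrow> ('x, 'k::comm_ring_1) mpoly set" where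
  "sqfree_power X d =
    ideal_of X {s. Poly_Mapping.keys s \<subseteq> X \<and> sqfree s \<and> mon_deg s = d}"

section \<open>Spanning trees and the ideal of a tree\<close>

text \<open>An undirected graph on a vertex set is given by its set of edges, which are two-element sets.
  (The trees of the entry \<open>Graph_Theory\<close> are directed graphs without directed cycles, so they are
  not the trees needed here.)\<close>

definition complete_edges :: "'v set \<Rightarrow> 'v set set" where
  "complete_edges V = {{u, v} | u v. u \<in> V \<and> v \<in> V \<and> u \<noteq> v}"

definition reachable :: "'v set set \<Rightarrow> 'v \<Rightarrow> 'v \<Rightarrow> bool" where
  "reachable E = (\<lambda>u v. {u, v} \<in> E)\<^sup>*\<^sup>*"

definition is_cycle :: "'v set set \<Rightarrow> 'v list \<Rightarrow> bool" where
  "is_cycle E vs \<longleftrightarrow> length vs \<ge> 3 \<and> distinct vs \<and>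
    (\<forall>i < length vs - 1. {vs ! i, vs ! Suc i} \<in> E) \<and> {last vs, hd vs} \<in> E"

definition spanning_tree :: "'v set \<Rightarrow> 'v set set \<Rightarrow> bool" where
  "spanning_tree V T \<longleftrightarrow> T \<subseteq> complete_edges V \<and>
    (\<forall>u\<in>V. \<forall>v\<in>V. reachable T u v) \<and> (\<nexists>vs. is_cycle T vs)"

text \<open>In the following, the edges of \<open>T\<close> are \<open>{v i, w i}\<close> for \<open>i \<in> L\<close>, and \<open>(j, i)\<close> is the label
  \<open>j\<^sup>(\<^sup>i\<^sup>)\<close>.\<close>

definition labels ::
    "nat set \<Rightarrow> (nat \<Rightarrow> nat) \<Rightarrow> (nat \<Rightarrow> nat) \<Rightarrow> nat set set \<Rightarrow> nat \<Rightarrow> (nat \<times> nat) set" where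
  "labels L v w T u =
    {(w i, i) | i. i \<in> L \<and> reachable (T - {{v i, w i}}) (v i) u} \<union>
    {(v i, i) | i. i \<in> L \<and> reachable (T - {{v i, w i}}) (w i) u}"

definition tree_gen ::
    "nat set \<Rightarrow> (nat \<Rightarrow> nat) \<Rightarrow> (nat \<Rightarrow> nat) \<Rightarrow> nat set set \<Rightarrow> nat \<Rightarrow> (nat \<times> nat) monomial" where
  "tree_gen L v w T u = (\<Sum>l\<in>labels L v w T u. Poly_Mapping.single l 1)"

definition copies :: "nat set \<Rightarrow> (nat \<Rightarrow> nat) \<Rightarrow> (nat \<Rightarrow> nat) \<Rightarrow> nat \<Rightarrow> nat set" where
  "copies L v w j = {i \<in> L. j \<in> {v i, w i}}"

end

theory Submission
  imports Defs "HOL-Library.Transitive_Closure_Table"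
begin

text \<open>The labels of a vertex \<open>u\<close> are in bijection with the other vertices: \<open>x \<noteq> u\<close> carries the edge at
  \<open>x\<close> towards \<open>u\<close>. Hence identifying all copies turns \<open>m\<^sub>u\<close> into the product of the \<open>x\<^sub>j\<close> with
  \<open>j \<noteq> u\<close>. The labels of \<open>u\<close> and \<open>u'\<close> differ exactly at the edges of the path between them, which
  gives the linear relations.

  For regularity, the quotient by the differences used so far is the quotient by the monomial ideal
  \<open>P'\<close> obtained by identifying the copies that these differences relate. On a quotient by a monomial
  ideal, the difference \<open>a - b\<close> of two variables is regular as soon as every monomial \<open>s\<close> with
  \<open>a s, b s \<in> P'\<close> lies in \<open>P'\<close>. If \<open>m\<^sub>u\<close> divides \<open>a s\<close> and \<open>m\<^sub>u\<^sub>'\<close> divides \<open>b s\<close>, with \<open>a\<close>, \<open>b\<close> different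
  copies of \<open>x\<^sub>z\<close>, then \<open>z\<close> lies on the path between \<open>u\<close> and \<open>u'\<close>, every label of \<open>z\<close> is a label of
  \<open>u\<close> or of \<open>u'\<close>, and none is a copy of \<open>x\<^sub>z\<close>; so \<open>m\<^sub>z\<close> divides \<open>s\<close>.\<close>

section \<open>Labels of a spanning tree\<close>

lemma reachable_refl [simp]: "reachable E u u"
  by (simp add: reachable_def)

lemma reachable_edge: "{u, v} \<in> E \<Longrightarrow> reachable E u v"
  by (auto simp: reachable_def)

lemma reachable_trans: "reachable E u v \<Longrightarrow> reachable E v x \<Longrightarrow> reachable E u x"
  by (auto simp: reachable_def)

lemma reachable_induct [consumes 1, case_names refl step]:
  assumes "reachable E u x" and "P u"
    and "\<And>a b. reachable E u a \<Longrightarrow> {a, b} \<in> E \<Longrightarrow> P a \<Longrightarrow> P b"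
  shows "P x"
  using assms unfolding reachable_def by (induction rule: rtranclp_induct) auto

lemma reachable_mono:
  assumes "reachable E u x" and "E \<subseteq> F"
  shows "reachable F u x"
  using assms by (induction rule: reachable_induct)
    (auto intro: reachable_trans reachable_edge)

lemma reachable_sym:
  assumes "reachable E u v"
  shows "reachable E v u"
  using assms
proof (induction rule: reachable_induct)
  case (step a b)
  then have "reachable E b a" by (simp add: reachable_edge insert_commute)
  then show ?case using step.IH by (rule reachable_trans)
qed simp

text \<open>Cut a walk from \<open>u\<close> at its first arrival at \<open>x\<close>;
  \<open>y\<close> is the vertex just before. The induction invariant is that either the walk so far
  avoids \<open>x\<close> or such an arrival has already occurred.\<close>

lemma reachable_avoiding:
  assumes "reachable E u x" and "u \<noteq> x"
  obtains y where "{x, y} \<in> E" and "reachable {e \<in> E. x \<notin> e} u y"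
proof -
  let ?F = "{e \<in> E. x \<notin> e}"
  \<comment> \<open>With all edges at \<open>x\<close> removed, \<open>x\<close> is isolated, so a
    vertex reached from \<open>u\<close> in \<open>?F\<close> cannot be \<open>x\<close>.\<close>
  have stuck: "a = x" if "reachable ?F x a" for a
    using that by (induction rule: reachable_induct) auto
  have "reachable ?F u c \<or> (\<exists>y. {x, y} \<in> E \<and> reachable ?F u y)" if "reachable E u c" for c
    using that
  proof (induction rule: reachable_induct)
    case refl
    then show ?case by simp
  next
    case (step a b)
    show ?case
    proof (cases "reachable ?F u a")
      case True
      show ?thesis
      proof (cases "x \<in> {a, b}")
        case False
        then have "{a, b} \<in> ?F" using step.hyps by auto
        from reachable_trans[OF True reachable_edge[OF this]] show ?thesis ..
      next
        case x: True
        have "a \<noteq> x" using True assms(2) reachable_sym stuck by metis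
        with x have "b = x" by simp
        then have "{x, a} \<in> E" using step.hyps(2) by (simp add: insert_commute)
        with True show ?thesis by blast
      qed
    qed (use step.IH in blast)
  qed
  from this[OF assms(1)] show ?thesis
  proof
    assume "reachable ?F u x"
    then have "u = x" by (rule stuck[OF reachable_sym])
    with assms(2) show ?thesis ..
  qed (use that in blast)
qed

text \<open>After its last use of the edge \<open>{a, b}\<close>, a walk from \<open>a\<close>
  continues from \<open>a\<close> or from \<open>b\<close> without that edge.\<close>

lemma reachable_diff_edge:
  assumes "reachable E a u"
  shows "reachable (E - {{a, b}}) a u \<or> reachable (E - {{a, b}}) b u"
  using assms
proof (induction rule: reachable_induct)
  case (step c d)
  show ?case
  proof (cases "{c, d} = {a, b}")
    case True
    then have "d = a \<or> d = b" by auto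
    then show ?thesis by auto
  next
    case False
    then have "{c, d} \<in> E - {{a, b}}" using step.hyps by simp
    then show ?thesis using step.IH by (meson reachable_edge reachable_trans)
  qed
qed simp

text \<open>A path from \<open>a\<close> to \<open>b\<close> that avoids the edge
  \<open>{a, b}\<close> would close up with it to a cycle.\<close>

lemma spanning_tree_bridge:
  assumes "spanning_tree V T" and e: "{a, b} \<in> T"
  shows "\<not> reachable (T - {{a, b}}) a b"
proof
  let ?R = "\<lambda>x y. {x, y} \<in> T - {{a, b}}"
  assume "reachable (T - {{a, b}}) a b"
  then obtain xs where "rtrancl_path ?R a xs b"
    unfolding reachable_def using rtranclp_eq_rtrancl_path by metis
  then obtain xs where xs: "rtrancl_path ?R a xs b" and dist: "distinct (a # xs)"
    by (metis rtrancl_path_distinct)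
  have ab: "a \<noteq> b"
    using assms unfolding spanning_tree_def complete_edges_def by (auto simp: doubleton_eq_iff)
  then have "xs \<noteq> []" using xs by (auto elim: rtrancl_path.cases)
  then have last: "last xs = b" using xs by (metis rtrancl_path_last)
  \<comment> \<open>A path of length one would be the removed edge itself. So the path has at least
    three vertices, as \<open>is_cycle\<close> demands.\<close>
  have "length xs \<noteq> 1"
  proof
    assume "length xs = 1"
    with last have "xs = [b]" by (cases xs) auto
    with rtrancl_path_nth[OF xs, of 0] show False by simp
  qed
  then have "length (a # xs) \<ge> 3" using \<open>xs \<noteq> []\<close> by (cases xs; cases "tl xs") auto
  moreover have "\<forall>i < length (a # xs) - 1. {(a # xs) ! i, (a # xs) ! Suc i} \<in> T"
    using rtrancl_path_nth[OF xs] by auto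
  moreover have "{last (a # xs), hd (a # xs)} \<in> T"
    using \<open>xs \<noteq> []\<close> last e by (simp add: insert_commute)
  ultimately have "is_cycle T (a # xs)"
    using dist unfolding is_cycle_def by blast
  with assms(1) show False unfolding spanning_tree_def by blast
qed

section \<open>Labels of a vertex, one for each edge and one for each other vertex\<close>

locale labelled_tree =
  fixes V L :: "nat set" and v w :: "nat \<Rightarrow> nat" and T :: "nat set set"
  assumes tree: "spanning_tree V T"
    and bij: "bij_betw (\<lambda>i. {v i, w i}) L T"
    and fin: "finite V" "finite L"
    and card_V: "card V = Suc (card L)"
begin

abbreviation lab :: "nat \<Rightarrow> (nat \<times> nat) set" where
  "lab \<equiv> labels L v w T"

lemma edge_in_T: "i \<in> L \<Longrightarrow> {v i, w i} \<in> T"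
  using bij by (auto simp: bij_betw_def)

lemma edge_inj: "i \<in> L \<Longrightarrow> j \<in> L \<Longrightarrow> {v i, w i} = {v j, w j} \<Longrightarrow> i = j"
  using bij by (auto simp: bij_betw_def inj_on_def)

lemma edge_ends: "{x, y} \<in> T \<Longrightarrow> x \<in> V \<and> y \<in> V \<and> x \<noteq> y"
  using tree unfolding spanning_tree_def complete_edges_def by (auto simp: doubleton_eq_iff)

lemma edge_label: "e \<in> T \<Longrightarrow> \<exists>i\<in>L. {v i, w i} = e"
  using bij by (auto simp: bij_betw_def)

lemma connected: "x \<in> V \<Longrightarrow> y \<in> V \<Longrightarrow> reachable T x y"
  using tree by (auto simp: spanning_tree_def)

text \<open>Removes the orientation from the definition: a label of \<open>u\<close> at edge
  \<open>i\<close> is the end of that edge on the side away from \<open>u\<close>, whether it is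
  \<open>v i\<close> or \<open>w i\<close>.\<close>

lemma mem_lab:
  "(x, i) \<in> lab u \<longleftrightarrow> i \<in> L \<and> (\<exists>y. {v i, w i} = {x, y} \<and> reachable (T - {{x, y}}) y u)"
  unfolding labels_def
  by (auto simp: doubleton_eq_iff insert_commute)

lemma mem_lab_edge:
  assumes "i \<in> L" and "{v i, w i} = {x, y}"
  shows "(x, i) \<in> lab u \<longleftrightarrow> reachable (T - {{x, y}}) y u"
  using assms unfolding mem_lab by (auto simp: doubleton_eq_iff)

text \<open>The two sides of an edge cover \<open>V\<close> by connectedness and are disjoint
  because the edge is a bridge.\<close>

lemma not_mem_lab_edge:
  assumes "i \<in> L" and "{v i, w i} = {x, y}" and "u \<in> V"
  shows "(x, i) \<notin> lab u \<longleftrightarrow> reachable (T - {{x, y}}) x u"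
proof -
  have e: "{x, y} \<in> T" using assms edge_in_T by metis
  then have "reachable T x u" using edge_ends connected assms(3) by metis
  then have "reachable (T - {{x, y}}) x u \<or> reachable (T - {{x, y}}) y u"
    by (rule reachable_diff_edge)
  moreover have "\<not> (reachable (T - {{x, y}}) x u \<and> reachable (T - {{x, y}}) y u)"
    using spanning_tree_bridge[OF tree e] by (metis reachable_sym reachable_trans)
  ultimately show ?thesis
    unfolding mem_lab_edge[OF assms(1,2)] by blast
qed

lemma lab_L: "(x, i) \<in> lab u \<Longrightarrow> i \<in> L"
  by (simp add: mem_lab)

lemma lab_V: "(x, i) \<in> lab u \<Longrightarrow> x \<in> V"
  unfolding mem_lab using edge_in_T edge_ends by metis

lemma lab_swap:
  assumes "i \<in> L" and "{v i, w i} = {x, y}" and "u \<in> V"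
  shows "(y, i) \<in> lab u \<longleftrightarrow> (x, i) \<notin> lab u"
proof -
  have "{v i, w i} = {y, x}" using assms(2) by (simp add: insert_commute)
  from mem_lab_edge[OF assms(1) this] not_mem_lab_edge[OF assms] show ?thesis
    by (simp add: insert_commute)
qed

lemma lab_neq_self: "u \<in> V \<Longrightarrow> (u, i) \<notin> lab u"
  using not_mem_lab_edge reachable_refl unfolding mem_lab by metis

text \<open>By \<open>lab_swap\<close>, exactly one end of each edge is a label of
  \<open>u\<close>.\<close>

lemma bij_snd_lab:
  assumes "u \<in> V"
  shows "bij_betw snd (lab u) L"
proof (rule bij_betw_imageI)
  show "inj_on snd (lab u)"
  proof (rule inj_onI, clarsimp)
    fix x x' i assume *: "(x, i) \<in> lab u" "(x', i) \<in> lab u"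
    then obtain y where "{v i, w i} = {x, y}" "i \<in> L" unfolding mem_lab by blast
    with * lab_swap[OF _ _ assms] show "x = x'"
      unfolding mem_lab by (metis doubleton_eq_iff mem_lab)
  qed
  show "snd ` lab u = L"
  proof (intro equalityI subsetI)
    fix i assume "i \<in> L"
    then show "i \<in> snd ` lab u"
      using lab_swap[OF _ refl assms, of i] by force
  qed (use lab_L in auto)
qed

lemma finite_lab: "u \<in> V \<Longrightarrow> finite (lab u)"
  using bij_snd_lab fin bij_betw_finite by metis

lemma card_lab: "u \<in> V \<Longrightarrow> card (lab u) = card L"
  using bij_snd_lab bij_betw_same_card by metis

text \<open>The edge through which a walk from \<open>u\<close> first enters \<open>x\<close> works:
  the walk before it avoids \<open>x\<close>, so it survives the removal of that edge.\<close>

lemma ex_lab: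
  assumes "u \<in> V" "x \<in> V" "x \<noteq> u"
  shows "\<exists>i. (x, i) \<in> lab u"
proof -
  have "reachable T u x" using connected assms by blast
  then obtain y where y: "{x, y} \<in> T" "reachable {e \<in> T. x \<notin> e} u y"
    using reachable_avoiding assms(3) by metis
  from y(1) obtain i where i: "i \<in> L" "{v i, w i} = {x, y}"
    using edge_label by metis
  have "reachable (T - {{x, y}}) u y" by (rule reachable_mono[OF y(2)]) auto
  then have "(x, i) \<in> lab u" using mem_lab_edge[OF i] reachable_sym by metis
  then show ?thesis ..
qed

text \<open>Injectivity comes from counting: every vertex other than \<open>u\<close> carries a label, and there are
  only as many labels as edges.\<close>
lemma bij_fst_lab:
  assumes "u \<in> V"
  shows "bij_betw fst (lab u) (V - {u})"
proof (rule bij_betw_imageI)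
  show img: "fst ` lab u = V - {u}"
  proof (intro equalityI subsetI)
    fix x assume "x \<in> V - {u}"
    then show "x \<in> fst ` lab u" using ex_lab[OF assms] by force
  next
    fix x assume "x \<in> fst ` lab u"
    then show "x \<in> V - {u}" using lab_V lab_neq_self[OF assms] by auto
  qed
  have "card (V - {u}) = card (lab u)"
    using assms fin card_V card_lab by simp
  with img show "inj_on fst (lab u)"
    using finite_lab[OF assms] by (simp add: eq_card_imp_inj_on)
qed

lemma lab_fst_unique:
  "u \<in> V \<Longrightarrow> (x, i) \<in> lab u \<Longrightarrow> (x, j) \<in> lab u \<Longrightarrow> i = j"
  using bij_fst_lab by (fastforce simp: bij_betw_def inj_on_def)

text \<open>If the edge \<open>g\<close> separates \<open>z\<close> from \<open>x\<close> and \<open>u\<close>, then the edge at \<open>z\<close> towards \<open>u\<close> is the edge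
  at \<open>z\<close> towards \<open>x\<close>: the path between \<open>u\<close> and \<open>x\<close> avoids \<open>z\<close>.\<close>
lemma lab_behind:
  assumes V: "u \<in> V" "z \<in> V" and g: "(x, g) \<in> lab z" "(x, g) \<notin> lab u"
    and d: "(z, d) \<in> lab x"
  shows "(z, d) \<in> lab u"
proof -
  obtain y where y: "g \<in> L" "{v g, w g} = {x, y}" using g(1) unfolding mem_lab by blast
  obtain z' where z': "d \<in> L" "{v d, w d} = {z, z'}" "reachable (T - {{z, z'}}) z' x"
    using d unfolding mem_lab by blast
  have xu: "reachable (T - {{x, y}}) x u" using not_mem_lab_edge[OF y V(1)] g(2) by blast
  have nxz: "\<not> reachable (T - {{x, y}}) x z" using not_mem_lab_edge[OF y V(2)] g(1) by blast
  \<comment> \<open>The walk stays on the side of \<open>x\<close> of the edge \<open>g\<close>.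
    Since \<open>z\<close> lies on the other side, the walk never uses
    \<open>{z, z'}\<close>.\<close>
  from xu have "reachable (T - {{z, z'}}) x u \<and> reachable (T - {{x, y}}) x u"
  proof (induction rule: reachable_induct)
    case (step a b)
    then have "z \<noteq> a" "z \<noteq> b" using nxz by (metis reachable_edge reachable_trans)+
    then have "{a, b} \<in> T - {{z, z'}}" using step.hyps by auto
    then show ?case using step by (metis reachable_edge reachable_trans)
  qed simp
  then have "reachable (T - {{z, z'}}) z' u" using z'(3) reachable_trans by metis
  then show ?thesis using mem_lab_edge[OF z'(1,2)] by simp
qed

text \<open>If a label \<open>(x, g)\<close> of \<open>z\<close> were missing from both sets, then
  by \<open>lab_behind\<close> the edge at \<open>z\<close> towards \<open>x\<close> would also lead
  towards \<open>u\<close> and towards \<open>u'\<close>, so \<open>a = b\<close>.\<close>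

lemma lab_subset_union:
  assumes V: "u \<in> V" "u' \<in> V" and z: "(z, a) \<in> lab u" "(z, b) \<in> lab u'" "a \<noteq> b"
  shows "lab z \<subseteq> lab u \<union> lab u'"
proof
  fix l assume l: "l \<in> lab z"
  obtain x g where lg: "l = (x, g)" by (cases l)
  have zV: "z \<in> V" using z(1) lab_V by blast
  have x: "x \<in> V" "x \<noteq> z" using l lg lab_V lab_neq_self[OF zV] by auto
  show "l \<in> lab u \<union> lab u'"
  proof (rule ccontr)
    assume "l \<notin> lab u \<union> lab u'"
    then have n: "(x, g) \<notin> lab u" "(x, g) \<notin> lab u'" using lg by auto
    obtain d where d: "(z, d) \<in> lab x" using ex_lab[OF x(1) zV] x(2) by blast
    have "(z, d) \<in> lab u" "(z, d) \<in> lab u'"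
      using lab_behind[OF V(1) zV _ n(1) d] lab_behind[OF V(2) zV _ n(2) d] l lg by auto
    then show False using lab_fst_unique z V by blast
  qed
qed

text \<open>The target set consists of the edges that separate \<open>x\<close> from
  \<open>y\<close>. It is symmetric in \<open>x\<close> and \<open>y\<close>, so it compares
  \<open>lab x - lab y\<close> with \<open>lab y - lab x\<close>.\<close>

lemma snd_lab_diff:
  assumes "x \<in> V" "y \<in> V"
  shows "bij_betw snd (lab x - lab y) {i \<in> L. \<forall>z. \<not> ((z, i) \<in> lab x \<and> (z, i) \<in> lab y)}"
proof (rule bij_betw_imageI)
  have inj: "inj_on snd (lab x)" using bij_snd_lab[OF assms(1)] by (simp add: bij_betw_def)
  then show "inj_on snd (lab x - lab y)" by (rule inj_on_subset) auto
  show "snd ` (lab x - lab y) = {i \<in> L. \<forall>z. \<not> ((z, i) \<in> lab x \<and> (z, i) \<in> lab y)}"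
  proof (intro equalityI subsetI)
    fix i assume "i \<in> snd ` (lab x - lab y)"
    then show "i \<in> {i \<in> L. \<forall>z. \<not> ((z, i) \<in> lab x \<and> (z, i) \<in> lab y)}"
      using inj lab_L unfolding inj_on_def by fastforce
  next
    fix i assume i: "i \<in> {i \<in> L. \<forall>z. \<not> ((z, i) \<in> lab x \<and> (z, i) \<in> lab y)}"
    then obtain z where "(z, i) \<in> lab x"
      using bij_snd_lab[OF assms(1)] unfolding bij_betw_def by force
    with i show "i \<in> snd ` (lab x - lab y)" by force
  qed
qed

text \<open>The labels differ at the edges of the path between \<open>x\<close> and
  \<open>y\<close>, so one difference means a path of one edge.\<close>

lemma edge_iff_card_lab_diff:
  assumes V: "x \<in> V" "y \<in> V"
  shows "{x, y} \<in> T \<longleftrightarrow> card (lab x - lab y) = 1"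
proof
  assume e: "{x, y} \<in> T"
  then have xy: "x \<noteq> y" using edge_ends by blast
  obtain i where i: "i \<in> L" "{v i, w i} = {x, y}" using edge_label[OF e] by blast
  have "lab x - lab y = {(y, i)}"
  proof (intro equalityI subsetI)
    fix l assume l: "l \<in> lab x - lab y"
    obtain z j where zj: "l = (z, j)" by (cases l)
    obtain z' where j: "j \<in> L" "{v j, w j} = {z, z'}" "reachable (T - {{z, z'}}) z' x"
      using l unfolding zj by (auto simp: mem_lab)
    have "\<not> reachable (T - {{z, z'}}) z' y" using l zj mem_lab_edge[OF j(1,2)] by simp
    \<comment> \<open>Edge \<open>j\<close> has \<open>x\<close> and \<open>y\<close> on opposite
      sides. The edge \<open>{x, y}\<close> would join the sides, so it is the removed edge.\<close>
    with j(3) have "{x, y} \<notin> T - {{z, z'}}" by (meson reachable_edge reachable_trans)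
    then have "{z, z'} = {x, y}" using e by auto
    then have "j = i" using edge_inj i j by metis
    moreover have "z \<noteq> x" using l zj lab_neq_self[OF V(1)] by blast
    ultimately show "l \<in> {(y, i)}" using zj \<open>{z, z'} = {x, y}\<close> by (auto simp: doubleton_eq_iff)
  next
    fix l assume "l \<in> {(y, i)}"
    then show "l \<in> lab x - lab y"
      using lab_swap[OF i V(1)] lab_neq_self V by auto
  qed
  then show "card (lab x - lab y) = 1" by simp
next
  let ?D = "{i \<in> L. \<forall>z. \<not> ((z, i) \<in> lab x \<and> (z, i) \<in> lab y)}"
  assume c: "card (lab x - lab y) = 1"
  have xy: "x \<noteq> y" using c by auto
  have D: "card ?D = 1" using c bij_betw_same_card[OF snd_lab_diff[OF V]] by simp
  \<comment> \<open>\<open>i\<close> is the edge at \<open>y\<close> towards \<open>x\<close>, and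
    \<open>j\<close> below is the edge at \<open>x\<close> towards \<open>y\<close>. Both separate
    \<open>x\<close> from \<open>y\<close>, so they coincide and contain both vertices.\<close>
  obtain i where i: "(y, i) \<in> lab x" using ex_lab V xy by metis
  obtain j where j: "(x, j) \<in> lab y" using ex_lab V xy by metis
  have "(y, i) \<in> lab x - lab y" using i lab_neq_self V by blast
  then have "i \<in> ?D" using snd_lab_diff[OF V] unfolding bij_betw_def by force
  have "(x, j) \<in> lab y - lab x" using j lab_neq_self V by blast
  then have "j \<in> ?D" using snd_lab_diff[OF V(2,1)] unfolding bij_betw_def by force
  moreover obtain d where d: "?D = {d}" using D by (rule card_1_singletonE)
  ultimately have "i = j" using \<open>i \<in> ?D\<close> unfolding d by simp
  have "x \<in> {v i, w i}" "y \<in> {v i, w i}" using i j \<open>i = j\<close> unfolding mem_lab by auto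
  then have "{x, y} = {v i, w i}" using xy by auto
  then show "{x, y} \<in> T" using edge_in_T lab_L[OF i] by metis
qed

end

section \<open>Polynomial rings and monomial ideals\<close>

lemma carrier_mpoly_ring:
  "carrier (mpoly_ring X) = {p. \<forall>s\<in>Poly_Mapping.keys p. Poly_Mapping.keys s \<subseteq> X}"
  by (simp add: mpoly_ring_def)

lemma mpoly_ring_simps [simp]:
  "mult (mpoly_ring X) = (*)" "one (mpoly_ring X) = 1"
  "zero (mpoly_ring X) = 0" "add (mpoly_ring X) = (+)"
  by (simp_all add: mpoly_ring_def)

lemma keys_add_nat:
  fixes s t :: "'x monomial"
  shows "Poly_Mapping.keys (s + t) = Poly_Mapping.keys s \<union> Poly_Mapping.keys t"
  by (auto simp: in_keys_iff lookup_add)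

lemma keys_uminus_eq: 
  fixes p :: "'a \<Rightarrow>\<^sub>0 'b::ab_group_add"
  shows "Poly_Mapping.keys (- p) = Poly_Mapping.keys p"
  by (auto simp: in_keys_iff)

lemma mpoly_carrier_closed:
  fixes p q :: "('x, 'k::comm_ring_1) mpoly"
  assumes "p \<in> carrier (mpoly_ring X)"
  shows "- p \<in> carrier (mpoly_ring X)"
    and "q \<in> carrier (mpoly_ring X) \<Longrightarrow> p + q \<in> carrier (mpoly_ring X)"
    and "q \<in> carrier (mpoly_ring X) \<Longrightarrow> p * q \<in> carrier (mpoly_ring X)"
  using assms keys_add[of p q] keys_mult[of p q]
  by (fastforce simp: carrier_mpoly_ring keys_add_nat keys_uminus_eq)+

lemma mpoly_carrier_0_1 [simp]:
  "0 \<in> carrier (mpoly_ring X)" "1 \<in> carrier (mpoly_ring X)"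
  by (simp_all add: carrier_mpoly_ring)

lemma cring_mpoly_ring: "cring (mpoly_ring X :: ('x, 'k::comm_ring_1) mpoly ring)"
proof (rule cringI)
  show "abelian_group (mpoly_ring X :: ('x, 'k) mpoly ring)"
  proof (rule abelian_groupI)
    fix p :: "('x, 'k) mpoly"
    assume "p \<in> carrier (mpoly_ring X)"
    then show "\<exists>q\<in>carrier (mpoly_ring X). q \<oplus>\<^bsub>mpoly_ring X\<^esub> p = \<zero>\<^bsub>mpoly_ring X\<^esub>"
      using mpoly_carrier_closed(1) by (intro bexI[of _ "- p"]) auto
  qed (auto simp: mpoly_carrier_closed add.assoc add.commute)
  show "Group.comm_monoid (mpoly_ring X :: ('x, 'k) mpoly ring)"
    by (rule comm_monoidI) (auto simp: mpoly_carrier_closed mult.assoc mult.commute)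
qed (auto simp: distrib_right)

lemma a_inv_mpoly_ring:
  fixes p :: "('x, 'k::comm_ring_1) mpoly"
  assumes "p \<in> carrier (mpoly_ring X)"
  shows "\<ominus>\<^bsub>mpoly_ring X\<^esub> p = - p"
proof -
  interpret cring "mpoly_ring X :: ('x, 'k) mpoly ring" by (rule cring_mpoly_ring)
  show ?thesis
    using minus_equality[of "- p" p] assms mpoly_carrier_closed(1) by auto
qed

lemma ideal_mpoly_ringI:
  fixes I :: "('x, 'k::comm_ring_1) mpoly set"
  assumes "I \<subseteq> carrier (mpoly_ring X)" and "0 \<in> I"
    and "\<And>p q. p \<in> I \<Longrightarrow> q \<in> I \<Longrightarrow> p + q \<in> I"
    and "\<And>p q. p \<in> I \<Longrightarrow> q \<in> carrier (mpoly_ring X) \<Longrightarrow> q * p \<in> I"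
  shows "ideal I (mpoly_ring X)"
proof -
  interpret cring "mpoly_ring X :: ('x, 'k) mpoly ring" by (rule cring_mpoly_ring)
  have "- p \<in> I" if "p \<in> I" for p
  proof -
    have "- (1 :: ('x, 'k) mpoly) \<in> carrier (mpoly_ring X)"
      by (simp add: mpoly_carrier_closed)
    from assms(4)[OF that this] show ?thesis by simp
  qed
  then have "\<ominus>\<^bsub>mpoly_ring X\<^esub> p \<in> I" if "p \<in> I" for p
    using that assms(1) a_inv_mpoly_ring by (metis subsetD)
  then have "subgroup I (add_monoid (mpoly_ring X))"
    using assms by (intro subgroup.intro) (auto simp: a_inv_def)
  then show ?thesis
    using assms(4) by (intro idealI ring_axioms) (auto simp: mult.commute)
qed

lemma mpoly_ideal_closed:
  fixes I :: "('x, 'k::comm_ring_1) mpoly set"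
  assumes "ideal I (mpoly_ring X)"
  shows "0 \<in> I" and "p \<in> I \<Longrightarrow> q \<in> I \<Longrightarrow> p + q \<in> I"
    and "p \<in> I \<Longrightarrow> q \<in> carrier (mpoly_ring X) \<Longrightarrow> q * p \<in> I"
    and "p \<in> I \<Longrightarrow> - p \<in> I" and "p \<in> I \<Longrightarrow> q \<in> I \<Longrightarrow> p - q \<in> I"
    and "I \<subseteq> carrier (mpoly_ring X)"
proof -
  interpret ideal I "mpoly_ring X" by (rule assms)
  show "0 \<in> I" using additive_subgroup.zero_closed[OF additive_subgroup_axioms] by simp
  show add: "p \<in> I \<Longrightarrow> q \<in> I \<Longrightarrow> p + q \<in> I" for p q using additive_subgroup.a_closed[OF additive_subgroup_axioms, of p q] by simp
  show "p \<in> I \<Longrightarrow> q \<in> carrier (mpoly_ring X) \<Longrightarrow> q * p \<in> I" using I_l_closed[of p q] by simp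
  show neg: "p \<in> I \<Longrightarrow> - p \<in> I" for p
    using additive_subgroup.a_inv_closed[OF additive_subgroup_axioms] a_inv_mpoly_ring[of p X]
      Icarr[of p] by metis
  show "p \<in> I \<Longrightarrow> q \<in> I \<Longrightarrow> p - q \<in> I" using add[of p "- q"] neg[of q] by simp
  show "I \<subseteq> carrier (mpoly_ring X)" using Icarr by blast
qed

lemma mpoly_ideal_sum:
  fixes I :: "('x, 'k::comm_ring_1) mpoly set"
  assumes "ideal I (mpoly_ring X)" and "\<And>a. a \<in> A \<Longrightarrow> f a \<in> I"
  shows "sum f A \<in> I"
  using assms(2)
  by (induction A rule: infinite_finite_induct) (auto intro: mpoly_ideal_closed[OF assms(1)])

section \<open>Renaming of variables as a pushforward\<close>

text \<open>Pushforward of a finitely supported function, summing over fibres. On exponent vectors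
  \<open>push g\<close> renames variables, and \<open>push (push g)\<close> is the induced ring
  homomorphism on polynomials.\<close>

definition push :: "('a \<Rightarrow> 'b) \<Rightarrow> ('a \<Rightarrow>\<^sub>0 'c::comm_monoid_add) \<Rightarrow> ('b \<Rightarrow>\<^sub>0 'c)" where
  "push g p = (\<Sum>x\<in>Poly_Mapping.keys p. Poly_Mapping.single (g x) (Poly_Mapping.lookup p x))"

lemma push_superset:
  assumes "finite A" and "Poly_Mapping.keys p \<subseteq> A"
  shows "push g p = (\<Sum>x\<in>A. Poly_Mapping.single (g x) (Poly_Mapping.lookup p x))"
  unfolding push_def
  by (rule sum.mono_neutral_left) (use assms in \<open>auto simp: in_keys_iff\<close>)

lemma push_0 [simp]: "push g 0 = 0"
  by (simp add: push_def)

lemma push_single [simp]: "push g (Poly_Mapping.single x c) = Poly_Mapping.single (g x) c"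
  by (simp add: push_def)

lemma push_add: "push g (p + q) = push g p + push g q"
proof -
  let ?A = "Poly_Mapping.keys p \<union> Poly_Mapping.keys q"
  have "Poly_Mapping.keys (p + q) \<subseteq> ?A" by (rule keys_add)
  then show ?thesis
    by (simp add: push_superset[of ?A] lookup_add single_add sum.distrib)
qed

lemma push_sum: "push g (sum f A) = (\<Sum>a\<in>A. push g (f a))"
  by (induction A rule: infinite_finite_induct) (auto simp: push_add)

lemma push_diff:
  fixes p q :: "'a \<Rightarrow>\<^sub>0 'c::ab_group_add"
  shows "push g (p - q) = push g p - push g q"
  using push_add[of g "p - q" q] by (simp add: algebra_simps)

lemma poly_mapping_expand:
  "p = (\<Sum>x\<in>Poly_Mapping.keys p. Poly_Mapping.single x (Poly_Mapping.lookup p x))"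
proof (rule poly_mapping_eqI)
  fix y
  show "Poly_Mapping.lookup p y = Poly_Mapping.lookup
    (\<Sum>x\<in>Poly_Mapping.keys p. Poly_Mapping.single x (Poly_Mapping.lookup p x)) y"
    by (simp add: lookup_sum lookup_single when_def in_keys_iff sum.delta)
qed

lemma push_push: "push f (push g p) = push (f \<circ> g) p"
  unfolding push_def[of g p] by (simp add: push_sum push_def[of "f \<circ> g"])

lemma push_ident:
  assumes "\<And>x. x \<in> Poly_Mapping.keys p \<Longrightarrow> g x = x"
  shows "push g p = p"
  using assms by (simp add: push_def poly_mapping_expand[symmetric])

lemma keys_push: "Poly_Mapping.keys (push g p) \<subseteq> g ` Poly_Mapping.keys p"
  unfolding push_def using keys_sum[of "\<lambda>x. Poly_Mapping.single (g x) (Poly_Mapping.lookup p x)"]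
  by (fastforce split: if_splits)

text \<open>Equality, in contrast to \<open>keys_push\<close>, because natural exponents cannot
  cancel.\<close>

lemma keys_push_nat:
  fixes s :: "'x monomial"
    and g :: "'x \<Rightarrow> 'y"
  shows "Poly_Mapping.keys (push g s) = g ` Poly_Mapping.keys s"
proof -
  have keys: "Poly_Mapping.keys (sum f A) = (\<Union>x\<in>A. Poly_Mapping.keys (f x))" if "finite A"
    for f :: "'x \<Rightarrow> 'y monomial" and A :: "'x set"
    using that by (induction A rule: finite_induct) (auto simp: keys_add_nat)
  show ?thesis
    unfolding push_def keys[OF finite_keys] by (auto simp: in_keys_iff)
qed

lemma push_mult:
  fixes p q :: "('a::comm_monoid_add) \<Rightarrow>\<^sub>0 ('c::comm_semiring_0)"
  assumes g: "\<And>x y. g (x + y) = g x + g y"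
  shows "push g (p * q) = push g p * push g q"
proof -
  have "p * q = (\<Sum>x\<in>Poly_Mapping.keys p. \<Sum>y\<in>Poly_Mapping.keys q.
      Poly_Mapping.single (x + y) (Poly_Mapping.lookup p x * Poly_Mapping.lookup q y))"
    by (subst (1) poly_mapping_expand[of p], subst (1) poly_mapping_expand[of q])
      (simp add: sum_product mult_single)
  then show ?thesis
    by (simp add: push_sum g) (simp add: push_def sum_product mult_single)
qed

lemma var_power: "(var x :: ('x, 'k::comm_ring_1) mpoly) ^ n = mono (Poly_Mapping.single x n)"
  by (induction n) (auto simp: var_def mono_def mult_single single_add[symmetric])

lemma prod_mono: "(\<Prod>a\<in>A. (mono (f a) :: ('x, 'k::comm_ring_1) mpoly)) = mono (sum f A)"
  by (induction A rule: infinite_finite_induct) (auto simp: mono_def mult_single)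

lemma subst_vars_var: "subst_vars (\<lambda>x. var (g x)) p = push (push g) p"
  unfolding subst_vars_def push_def[of "push g"]
  by (simp add: var_power prod_mono push_def) (simp add: mono_def mult_single)

lemma push_var: "push (push g) (var x) = (var (g x) :: ('x, 'k::comm_ring_1) mpoly)"
  by (simp add: var_def mono_def)

lemma push_push_mult:
  fixes p q :: "('x, 'k::comm_ring_1) mpoly"
  shows "push (push g) (p * q) = push (push g) p * push (push g) q"
  by (rule push_mult) (rule push_add)

lemma push_one: "push (push g) (1 :: ('a, 'k) mpoly) = (1 :: ('y, 'k::comm_ring_1) mpoly)"
  using push_single[of "push g" "0 :: 'a monomial" "1 :: 'k"]
  unfolding push_0 single_one .

lemma push_carrier:
  assumes "p \<in> carrier (mpoly_ring X)" and "g ` X \<subseteq> Y"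
  shows "push (push g) p \<in> carrier (mpoly_ring Y)"
  using assms keys_push[of "push g" p] by (fastforce simp: carrier_mpoly_ring keys_push_nat)

lemma single_carrier: "Poly_Mapping.keys s \<subseteq> X \<Longrightarrow> Poly_Mapping.single s c \<in> carrier (mpoly_ring X)"
  by (simp add: carrier_mpoly_ring)

lemma var_carrier: "x \<in> X \<Longrightarrow> (var x :: ('x, 'k::comm_ring_1) mpoly) \<in> carrier (mpoly_ring X)"
  by (simp add: var_def mono_def single_carrier)

section \<open>Membership in monomial ideals\<close>

definition mon_dvd :: "'x monomial \<Rightarrow> 'x monomial \<Rightarrow> bool" where
  "mon_dvd s t \<longleftrightarrow> (\<exists>r. t = r + s)"

text \<open>The right-hand side describes an ideal that contains the generators. Conversely, each
  term of such a polynomial is a multiple of a generator, and the polynomial is the sum of its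
  terms.\<close>

lemma mem_ideal_of:
  fixes p :: "('x, 'k::comm_ring_1) mpoly"
  assumes M: "\<And>s. s \<in> M \<Longrightarrow> Poly_Mapping.keys s \<subseteq> X"
  shows "p \<in> ideal_of X M \<longleftrightarrow>
    p \<in> carrier (mpoly_ring X) \<and> (\<forall>s\<in>Poly_Mapping.keys p. \<exists>m\<in>M. mon_dvd m s)"
proof -
  interpret cring "mpoly_ring X :: ('x, 'k) mpoly ring" by (rule cring_mpoly_ring)
  let ?I = "{p :: ('x, 'k) mpoly. p \<in> carrier (mpoly_ring X) \<and>
    (\<forall>s\<in>Poly_Mapping.keys p. \<exists>m\<in>M. mon_dvd m s)}"
  have gens: "(mono ` M :: ('x, 'k) mpoly set) \<subseteq> carrier (mpoly_ring X)"
    using M by (auto simp: mono_def single_carrier)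
  have id: "ideal (ideal_of X M :: ('x, 'k) mpoly set) (mpoly_ring X)"
    unfolding ideal_of_def by (rule genideal_ideal[OF gens])
  have "ideal ?I (mpoly_ring X)"
  proof (rule ideal_mpoly_ringI)
    fix p q :: "('x, 'k) mpoly"
    assume "p \<in> ?I" "q \<in> ?I"
    then show "p + q \<in> ?I" using keys_add[of p q] mpoly_carrier_closed(2) by blast
  next
    fix p q :: "('x, 'k) mpoly"
    assume p: "p \<in> ?I" and q: "q \<in> carrier (mpoly_ring X)"
    have "\<exists>m\<in>M. mon_dvd m s" if "s \<in> Poly_Mapping.keys (q * p)" for s
    proof -
      from that obtain a b where "s = a + b" "b \<in> Poly_Mapping.keys p"
        using keys_mult[of q p] by blast
      with p show ?thesis by (auto simp: mon_dvd_def) (metis add.assoc)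
    qed
    then show "q * p \<in> ?I" using p q mpoly_carrier_closed(3) by blast
  qed (auto simp: carrier_mpoly_ring)
  moreover have "mono ` M \<subseteq> ?I"
    using gens by (auto simp: mono_def mon_dvd_def) (metis add_0)
  ultimately have "ideal_of X M \<subseteq> ?I"
    unfolding ideal_of_def by (rule genideal_minimal)
  moreover have "p \<in> ideal_of X M" if p: "p \<in> ?I" for p
  proof -
    have "Poly_Mapping.single s (Poly_Mapping.lookup p s) \<in> ideal_of X M"
      if s: "s \<in> Poly_Mapping.keys p" for s
    proof -
      from p s obtain m r where m: "m \<in> M" "s = r + m" unfolding mon_dvd_def by blast
      have "Poly_Mapping.keys r \<subseteq> X" using p s keys_add_nat[of r m] by (auto simp: carrier_mpoly_ring m(2))
      then have "Poly_Mapping.single r (Poly_Mapping.lookup p s) * mono m \<in> ideal_of X M"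
        using genideal_self[OF gens] m(1) mpoly_ideal_closed(3)[OF id]
        by (metis ideal_of_def image_subset_iff single_carrier)
      then show ?thesis using m(2) by (simp add: mono_def mult_single)
    qed
    then have "(\<Sum>s\<in>Poly_Mapping.keys p. Poly_Mapping.single s (Poly_Mapping.lookup p s)) \<in> ideal_of X M"
      by (rule mpoly_ideal_sum[OF id])
    then show ?thesis by (simp add: poly_mapping_expand[symmetric])
  qed
  ultimately show ?thesis by blast
qed

lemma ideal_ideal_of:
  assumes "\<And>s. s \<in> M \<Longrightarrow> Poly_Mapping.keys s \<subseteq> X"
  shows "ideal (ideal_of X M :: ('x, 'k::comm_ring_1) mpoly set) (mpoly_ring X)"
proof -
  interpret cring "mpoly_ring X :: ('x, 'k) mpoly ring" by (rule cring_mpoly_ring)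
  show ?thesis
    unfolding ideal_of_def
    by (rule genideal_ideal) (use assms in \<open>auto simp: mono_def single_carrier\<close>)
qed

definition sqfree_mon :: "'x set \<Rightarrow> 'x monomial" where
  "sqfree_mon A = (\<Sum>x\<in>A. Poly_Mapping.single x 1)"

lemma lookup_sqfree_mon: "finite A \<Longrightarrow> Poly_Mapping.lookup (sqfree_mon A) x = (if x \<in> A then 1 else 0)"
  by (simp add: sqfree_mon_def lookup_sum lookup_single when_def sum.delta)

lemma keys_sqfree_mon: "finite A \<Longrightarrow> Poly_Mapping.keys (sqfree_mon A) = A"
  by (auto simp: in_keys_iff lookup_sqfree_mon split: if_splits)

lemma sqfree_sqfree_mon: "finite A \<Longrightarrow> sqfree (sqfree_mon A)"
  by (simp add: sqfree_def lookup_sqfree_mon)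

lemma sqfree_eq_sqfree_mon:
  assumes "sqfree s"
  shows "s = sqfree_mon (Poly_Mapping.keys s)"
proof (rule poly_mapping_eqI)
  fix x
  have "Poly_Mapping.lookup s x \<le> 1" using assms by (simp add: sqfree_def)
  then show "Poly_Mapping.lookup s x = Poly_Mapping.lookup (sqfree_mon (Poly_Mapping.keys s)) x"
    by (auto simp: lookup_sqfree_mon in_keys_iff)
qed

lemma mon_deg_sqfree_mon: "finite A \<Longrightarrow> mon_deg (sqfree_mon A) = card A"
  by (simp add: mon_deg_def keys_sqfree_mon lookup_sqfree_mon)

lemma mon_lcm_sqfree_mon:
  assumes "finite A" "finite B"
  shows "mon_lcm (sqfree_mon A) (sqfree_mon B) = sqfree_mon (A \<union> B)"
proof -
  have "mon_lcm (sqfree_mon A) (sqfree_mon B) = (\<Sum>x\<in>A \<union> B. Poly_Mapping.single x 1)"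
    unfolding mon_lcm_def keys_sqfree_mon[OF assms(1)] keys_sqfree_mon[OF assms(2)]
    by (rule sum.cong) (auto simp: lookup_sqfree_mon assms)
  then show ?thesis by (simp add: sqfree_mon_def)
qed

lemma push_sqfree_mon: "inj_on g A \<Longrightarrow> push g (sqfree_mon A) = sqfree_mon (g ` A)"
  by (simp add: sqfree_mon_def push_sum sum.reindex)

lemma sqfree_mon_dvd_iff:
  assumes "finite A"
  shows "mon_dvd (sqfree_mon A) s \<longleftrightarrow> A \<subseteq> Poly_Mapping.keys s"
proof
  assume "mon_dvd (sqfree_mon A) s"
  then show "A \<subseteq> Poly_Mapping.keys s"
    using keys_sqfree_mon[OF assms] by (auto simp: mon_dvd_def keys_add_nat)
next
  assume A: "A \<subseteq> Poly_Mapping.keys s"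
  have "s = (s - sqfree_mon A) + sqfree_mon A"
  proof (rule poly_mapping_eqI)
    fix x
    show "Poly_Mapping.lookup s x = Poly_Mapping.lookup ((s - sqfree_mon A) + sqfree_mon A) x"
      using A by (auto simp: lookup_add lookup_minus lookup_sqfree_mon assms in_keys_iff subset_iff)
  qed
  then show "mon_dvd (sqfree_mon A) s" unfolding mon_dvd_def by blast
qed

text \<open>For square-free generators divisibility is inclusion of supports, so all later
  membership questions concern finite sets of variables.\<close>

lemma mem_ideal_of_sqfree_mon:
  fixes p :: "('x, 'k::comm_ring_1) mpoly"
  assumes "\<And>i. i \<in> I \<Longrightarrow> finite (A i) \<and> A i \<subseteq> X"
  shows "p \<in> ideal_of X ((\<lambda>i. sqfree_mon (A i)) ` I) \<longleftrightarrow>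
    p \<in> carrier (mpoly_ring X) \<and> (\<forall>s\<in>Poly_Mapping.keys p. \<exists>i\<in>I. A i \<subseteq> Poly_Mapping.keys s)"
proof -
  let ?M = "(\<lambda>i. sqfree_mon (A i)) ` I"
  have "\<And>s. s \<in> ?M \<Longrightarrow> Poly_Mapping.keys s \<subseteq> X"
    using assms by (auto simp: keys_sqfree_mon subset_iff)
  then have "p \<in> ideal_of X ?M \<longleftrightarrow>
      p \<in> carrier (mpoly_ring X) \<and> (\<forall>s\<in>Poly_Mapping.keys p. \<exists>m\<in>?M. mon_dvd m s)"
    by (rule mem_ideal_of)
  then show ?thesis
    using assms by (simp add: sqfree_mon_dvd_iff)
qed

text \<open>The truncated subtraction \<open>r - t\<close> is exact when \<open>t\<close> divides
  \<open>r\<close>.\<close>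

lemma lookup_mono_mult:
  fixes p :: "('x, 'k::comm_ring_1) mpoly"
  shows "Poly_Mapping.lookup (mono t * p) r =
    (if mon_dvd t r then Poly_Mapping.lookup p (r - t) else 0)"
proof -
  have eq: "mono t * p = push ((+) t) p"
    by (subst poly_mapping_expand[of p]) (simp add: push_def mono_def sum_distrib_left mult_single)
  show ?thesis
  proof (cases "mon_dvd t r")
    case True
    then obtain s where r: "r = t + s" by (auto simp: mon_dvd_def add.commute)
    then show ?thesis
      using True unfolding eq push_def
      by (simp add: lookup_sum lookup_single when_def sum.delta in_keys_iff)
  next
    case False
    then have "t + s \<noteq> r" for s by (auto simp: mon_dvd_def add.commute)
    then show ?thesis
      using False unfolding eq push_def by (auto simp: lookup_sum lookup_single when_def intro!: sum.neutral)
  qed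
qed

text \<open>Let \<open>s\<close> be a monomial of \<open>p\<close> outside \<open>U\<close> with maximal exponent of \<open>a\<close>. The term \<open>a s\<close> is
  not cancelled in \<open>(a - b) p\<close>, so it is in \<open>U\<close>, and then no \<open>b\<^sup>k s\<close> is. Hence \<open>b s\<close> must be
  cancelled by \<open>a s'\<close> with \<open>s' = s b / a\<close>, and so on with \<open>s b\<^sup>k / a\<^sup>k\<close> for all \<open>k\<close>.\<close>
lemma var_diff_mult_regular:
  fixes p :: "('x, 'k::comm_ring_1) mpoly"
  assumes up: "\<And>s t. s \<in> U \<Longrightarrow> t + s \<in> U"
    and meet: "\<And>s. Poly_Mapping.single a 1 + s \<in> U \<Longrightarrow> Poly_Mapping.single b 1 + s \<in> U \<Longrightarrow> s \<in> U"
    and ab: "a \<noteq> b"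
    and U: "Poly_Mapping.keys ((var a - var b) * p) \<subseteq> U"
  shows "Poly_Mapping.keys p \<subseteq> U"
proof (rule ccontr)
  let ?a = "Poly_Mapping.single a (1::nat)" and ?b = "Poly_Mapping.single b (1::nat)"
  let ?B = "Poly_Mapping.keys p - U"
  \<comment> \<open>Stated for both orders of \<open>a\<close> and \<open>b\<close>: one order gives
    \<open>as\<close>, the other drives the chain of monomials.\<close>
  have shift: "\<exists>t\<in>?B. y + t = x + s"
    if xy: "(x, y) = (?a, ?b) \<or> (x, y) = (?b, ?a)" and s: "s \<in> ?B" and n: "x + s \<notin> U" for x y s
  proof -
    have "Poly_Mapping.lookup ((var a - var b) * p) (x + s) = 0"
      using U n by (auto simp: in_keys_iff)
    then have "Poly_Mapping.lookup (mono x * p) (x + s) = Poly_Mapping.lookup (mono y * p) (x + s)"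
      using xy by (auto simp: var_def left_diff_distrib lookup_minus)
    moreover have "Poly_Mapping.lookup (mono x * p) (x + s) = Poly_Mapping.lookup p s"
      by (auto simp: lookup_mono_mult mon_dvd_def add.commute)
    ultimately have "Poly_Mapping.lookup (mono y * p) (x + s) \<noteq> 0"
      using s by (simp add: in_keys_iff)
    then have "mon_dvd y (x + s)" "Poly_Mapping.lookup p (x + s - y) \<noteq> 0"
      by (auto simp: lookup_mono_mult split: if_splits)
    then obtain t where t: "x + s = y + t" "t \<in> Poly_Mapping.keys p"
      by (auto simp: mon_dvd_def add.commute in_keys_iff)
    then show ?thesis using n up by (metis DiffI)
  qed
  assume "\<not> Poly_Mapping.keys p \<subseteq> U"
  then have "?B \<noteq> {}" by blast
  then have "Max ((\<lambda>t. Poly_Mapping.lookup t a) ` ?B) \<in> (\<lambda>t. Poly_Mapping.lookup t a) ` ?B"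
    by (intro Max_in) auto
  then obtain s where s: "s \<in> ?B"
    and "Poly_Mapping.lookup s a = Max ((\<lambda>t. Poly_Mapping.lookup t a) ` ?B)" by auto
  then have max: "Poly_Mapping.lookup t a \<le> Poly_Mapping.lookup s a" if "t \<in> ?B" for t
    using that by simp
  have as: "?a + s \<in> U"
  proof (rule ccontr)
    assume "?a + s \<notin> U"
    from shift[OF _ s this] obtain t where t: "t \<in> ?B" "?b + t = ?a + s" by blast
    from t(2) have "Poly_Mapping.lookup (?b + t) a = Poly_Mapping.lookup (?a + s) a" by simp
    with ab max[OF t(1)] show False by (simp add: lookup_add lookup_single when_def)
  qed
  have bs: "Poly_Mapping.single b k + s \<notin> U" for k
  proof (induction k)
    case 0
    then show ?case using s by simp
  next
    case (Suc k)
    have "Poly_Mapping.single b k + (?a + s) \<in> U" by (rule up[OF as])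
    then have "?a + (Poly_Mapping.single b k + s) \<in> U" by (simp add: ac_simps)
    then have "?b + (Poly_Mapping.single b k + s) \<notin> U" using Suc meet by blast
    then show ?case by (simp add: add.assoc[symmetric] single_add[symmetric])
  qed
  have "\<exists>t\<in>?B. Poly_Mapping.single a k + t = Poly_Mapping.single b k + s" for k
  proof (induction k)
    case 0
    then show ?case using s by simp
  next
    case (Suc k)
    then obtain t where t: "t \<in> ?B" "Poly_Mapping.single a k + t = Poly_Mapping.single b k + s"
      by blast
    have eq: "Poly_Mapping.single a k + (?b + t) = Poly_Mapping.single b (Suc k) + s"
    proof -
      have "Poly_Mapping.single a k + (?b + t) = ?b + (Poly_Mapping.single a k + t)"
        by (simp add: ac_simps)
      also have "\<dots> = ?b + (Poly_Mapping.single b k + s)" by (simp only: t(2))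
      finally show ?thesis by (simp add: add.assoc[symmetric] single_add[symmetric])
    qed
    \<comment> \<open>Multiplying by the \<open>k\<close>-th power of \<open>a\<close> turns this
      monomial into the one excluded by \<open>bs\<close>, and \<open>U\<close> is closed under
      multiples.\<close>
    have "?b + t \<notin> U" using bs[of "Suc k"] up[of "?b + t" "Poly_Mapping.single a k"] eq by metis
    from shift[OF _ t(1) this] obtain t' where t': "t' \<in> ?B" "?a + t' = ?b + t" by blast
    have "Poly_Mapping.single a (Suc k) + t' = Poly_Mapping.single a k + (?a + t')"
      by (simp add: add.assoc[symmetric] single_add[symmetric])
    also have "\<dots> = Poly_Mapping.single b (Suc k) + s" by (simp only: t'(2) eq)
    finally show ?case using t'(1) by blast
  qed
  \<comment> \<open>One more power of \<open>a\<close> than \<open>s\<close> contains: the exponents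
    of \<open>a\<close> on the two sides then disagree.\<close>
  from this[of "Suc (Poly_Mapping.lookup s a)"] obtain t where
    "Poly_Mapping.single a (Suc (Poly_Mapping.lookup s a)) + t =
      Poly_Mapping.single b (Suc (Poly_Mapping.lookup s a)) + s" by blast
  then have "Poly_Mapping.lookup (Poly_Mapping.single a (Suc (Poly_Mapping.lookup s a)) + t) a =
      Poly_Mapping.lookup (Poly_Mapping.single b (Suc (Poly_Mapping.lookup s a)) + s) a" by simp
  then show False using ab by (simp add: lookup_add lookup_single when_def)
qed

section \<open>Regular sequences in quotient rings\<close>

text \<open>The correspondence between ideals of the quotient and ideals containing
  \<open>J\<close>: the image of \<open>Idl (J \<union> D)\<close> and the preimage of the quotient
  ideal are both ideals. It moves regularity from cosets back to \<open>R\<close>.\<close>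

lemma (in ring) coset_mem_Idl_quot_iff:
  assumes J: "ideal J R" and D: "D \<subseteq> carrier R" and p: "p \<in> carrier R"
  shows "J +> p \<in> Idl\<^bsub>R Quot J\<^esub> ((+>) J ` D) \<longleftrightarrow> p \<in> Idl (J \<union> D)"
proof
  interpret J: ideal J R by (rule J)
  interpret h: ring_hom_ring R "R Quot J" "(+>) J" by (rule J.rcos_ring_hom_ring)
  have JD: "J \<union> D \<subseteq> carrier R" using D J.Icarr by blast
  have idl: "ideal (Idl (J \<union> D)) R" by (rule genideal_ideal[OF JD])
  interpret K: ideal "Idl (J \<union> D)" R by (rule idl)
  have im: "(+>) J ` D \<subseteq> carrier (R Quot J)" using D h.hom_closed by blast
  {
    assume "J +> p \<in> Idl\<^bsub>R Quot J\<^esub> ((+>) J ` D)"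
    moreover have "Idl\<^bsub>R Quot J\<^esub> ((+>) J ` D) \<subseteq> (+>) J ` (Idl (J \<union> D))"
      by (rule h.S.genideal_minimal[OF ring_ideal_imp_quot_ideal[OF J idl]])
        (use genideal_self[OF JD] in blast)
    ultimately obtain q where q: "q \<in> Idl (J \<union> D)" "J +> p = J +> q" by blast
    then have "p \<ominus> q \<in> J" using quotient_eq_iff_same_a_r_cos[OF J p] K.Icarr by blast
    then have "p \<ominus> q \<in> Idl (J \<union> D)" using genideal_self[OF JD] by blast
    then have "(p \<ominus> q) \<oplus> q \<in> Idl (J \<union> D)" using q(1) K.a_closed by blast
    moreover have "(p \<ominus> q) \<oplus> q = p" using p K.Icarr[OF q(1)] by algebra
    ultimately show "p \<in> Idl (J \<union> D)" by simp
  next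
    assume pJD: "p \<in> Idl (J \<union> D)"
    let ?I = "Idl\<^bsub>R Quot J\<^esub> ((+>) J ` D)"
    have I: "ideal ?I (R Quot J)" by (rule h.S.genideal_ideal[OF im])
    interpret I: ideal ?I "R Quot J" by (rule I)
    have "J +> x \<in> ?I" if "x \<in> J" for x
    proof -
      have "J +> x = \<zero>\<^bsub>R Quot J\<^esub>"
        unfolding FactRing_def using J.a_rcos_const[OF that] by (simp only: ring_record_simps)
      then show ?thesis using I.zero_closed by (simp only:)
    qed
    then have "Idl (J \<union> D) \<subseteq> {r \<in> carrier R. J +> r \<in> ?I}"
      using JD h.S.genideal_self[OF im] by (intro genideal_minimal h.ideal_vimage[OF I]) blast
    with pJD show "J +> p \<in> ?I" by blast
  }
qed

lemma (in ring) regular_sequence_quotI: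
  assumes J: "ideal J R" and ds: "set ds \<subseteq> carrier R"
    and reg: "\<And>i p. i < length ds \<Longrightarrow> p \<in> carrier R \<Longrightarrow>
      ds ! i \<otimes> p \<in> Idl (J \<union> set (take i ds)) \<Longrightarrow> p \<in> Idl (J \<union> set (take i ds))"
    and proper: "\<one> \<notin> Idl (J \<union> set ds)"
  shows "regular_sequence (R Quot J) (map ((+>) J) ds)"
  unfolding regular_sequence_def
proof (intro conjI allI impI ballI)
  interpret J: ideal J R by (rule J)
  interpret h: ring_hom_ring R "R Quot J" "(+>) J" by (rule J.rcos_ring_hom_ring)
  show "set (map ((+>) J) ds) \<subseteq> carrier (R Quot J)" using ds h.hom_closed by auto
  show "Idl\<^bsub>R Quot J\<^esub> set (map ((+>) J) ds) \<noteq> carrier (R Quot J)"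
    using coset_mem_Idl_quot_iff[OF J ds one_closed] proper h.hom_closed[OF one_closed] by auto
  fix i a
  assume i: "i < length (map ((+>) J) ds)" and a: "a \<in> carrier (R Quot J)"
    and mem: "map ((+>) J) ds ! i \<otimes>\<^bsub>R Quot J\<^esub> a \<in> Idl\<^bsub>R Quot J\<^esub> set (take i (map ((+>) J) ds))"
  obtain p where p: "p \<in> carrier R" "a = J +> p"
    using a unfolding FactRing_simps by auto
  have di: "ds ! i \<in> carrier R" using i ds by auto
  have t: "set (take i ds) \<subseteq> carrier R" using ds set_take_subset by fastforce
  have "J +> (ds ! i \<otimes> p) = map ((+>) J) ds ! i \<otimes>\<^bsub>R Quot J\<^esub> a"
    using h.hom_mult[OF di p(1)] p(2) i by (simp only: nth_map length_map)
  then have "J +> (ds ! i \<otimes> p) \<in> Idl\<^bsub>R Quot J\<^esub> ((+>) J ` set (take i ds))"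
    using mem by (simp only: take_map set_map)
  then have "ds ! i \<otimes> p \<in> Idl (J \<union> set (take i ds))"
    using coset_mem_Idl_quot_iff[OF J t m_closed[OF di p(1)]] by (simp only:)
  then have "p \<in> Idl (J \<union> set (take i ds))" using reg i p(1) by (simp only: length_map)
  then show "a \<in> Idl\<^bsub>R Quot J\<^esub> set (take i (map ((+>) J) ds))"
    using coset_mem_Idl_quot_iff[OF J t p(1)] p(2) by (simp only: take_map set_map)
qed

section \<open>Substitution of variables\<close>

text \<open>Congruence modulo \<open>N\<close> respects products, by telescoping.\<close>

lemma mpoly_ideal_diff_mult:
  fixes N :: "('x, 'k::comm_ring_1) mpoly set"
  assumes N: "ideal N (mpoly_ring X)"
    and "a - a' \<in> N" "b - b' \<in> N" "a \<in> carrier (mpoly_ring X)" "b' \<in> carrier (mpoly_ring X)"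
  shows "a * b - a' * b' \<in> N"
proof -
  have "a * (b - b') + b' * (a - a') \<in> N"
    using assms by (intro mpoly_ideal_closed(2,3)[OF N])
  then show ?thesis by (simp add: algebra_simps)
qed

text \<open>The congruences between variables extend to powers, then to monomials, terms and sums of
  terms.\<close>

lemma push_diff_mem_ideal:
  fixes N :: "('x, 'k::comm_ring_1) mpoly set"
  assumes N: "ideal N (mpoly_ring X)" and g: "g ` X \<subseteq> X"
    and vars: "\<And>x. x \<in> X \<Longrightarrow> var (g x) - var x \<in> N"
    and p: "p \<in> carrier (mpoly_ring X)"
  shows "push (push g) p - p \<in> N"
proof -
  have pow: "mono (Poly_Mapping.single (g x) n) - mono (Poly_Mapping.single x n) \<in> N"
    if x: "x \<in> X" for x n
  proof (induction n)
    case 0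
    then show ?case using mpoly_ideal_closed(1)[OF N] by simp
  next
    case (Suc n)
    have "var (g x) * mono (Poly_Mapping.single (g x) n) - var x * mono (Poly_Mapping.single x n) \<in> N"
      using x g by (intro mpoly_ideal_diff_mult[OF N vars[OF x] Suc])
        (auto simp: mono_def intro!: var_carrier single_carrier split: if_splits)
    then show ?case by (simp add: var_def mono_def mult_single single_add[symmetric])
  qed
  have mon: "mono (\<Sum>x\<in>A. Poly_Mapping.single (g x) (f x)) -
      mono (\<Sum>x\<in>A. Poly_Mapping.single x (f x)) \<in> N" if "finite A" "A \<subseteq> X" for A and f :: "'x \<Rightarrow> nat"
    using that
  proof (induction A rule: finite_induct)
    case empty
    then show ?case using mpoly_ideal_closed(1)[OF N] by simp
  next
    case (insert x A)
    have "Poly_Mapping.keys (\<Sum>x\<in>A. Poly_Mapping.single x (f x)) \<subseteq> X"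
      using keys_sum[of "\<lambda>x. Poly_Mapping.single x (f x)" A] insert.prems
      by (fastforce split: if_splits)
    then have "mono (Poly_Mapping.single (g x) (f x)) * mono (\<Sum>x\<in>A. Poly_Mapping.single (g x) (f x)) -
        mono (Poly_Mapping.single x (f x)) * mono (\<Sum>x\<in>A. Poly_Mapping.single x (f x)) \<in> N"
      using insert g by (intro mpoly_ideal_diff_mult[OF N pow])
        (auto simp: mono_def intro!: single_carrier split: if_splits)
    then show ?case using insert.hyps by (simp add: mono_def mult_single)
  qed
  have "Poly_Mapping.single (push g s) c - Poly_Mapping.single s c \<in> N"
    if "Poly_Mapping.keys s \<subseteq> X" for s and c :: 'k
  proof -
    have "mono (push g s) - mono s \<in> N"
      using mon[OF finite_keys that, of "Poly_Mapping.lookup s"]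
      by (simp add: push_def poly_mapping_expand[symmetric])
    then have "Poly_Mapping.single 0 c * (mono (push g s) - mono s) \<in> N"
      by (intro mpoly_ideal_closed(3)[OF N] single_carrier) auto
    then show ?thesis by (simp add: mono_def right_diff_distrib mult_single)
  qed
  then have "(\<Sum>s\<in>Poly_Mapping.keys p. Poly_Mapping.single (push g s) (Poly_Mapping.lookup p s) -
      Poly_Mapping.single s (Poly_Mapping.lookup p s)) \<in> N"
    using p by (intro mpoly_ideal_sum[OF N]) (simp add: carrier_mpoly_ring)
  then show ?thesis
    by (simp add: sum_subtractf push_def[of "push g"] poly_mapping_expand[symmetric])
qed

text \<open>Modulo the differences in \<open>F\<close>, the substitution \<open>g\<close> changes nothing, so the ideal generated
  by \<open>M\<close> and \<open>F\<close> is the preimage of a monomial ideal under \<open>g\<close>.\<close>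
lemma mem_Idl_union_iff_push:
  fixes F :: "('x, 'k::comm_ring_1) mpoly set"
  assumes M: "\<And>s. s \<in> M \<Longrightarrow> Poly_Mapping.keys s \<subseteq> X" and g: "g ` X \<subseteq> X"
    and F: "F \<subseteq> carrier (mpoly_ring X)" "\<And>f. f \<in> F \<Longrightarrow> push (push g) f = 0"
    and vars: "\<And>x. x \<in> X \<Longrightarrow> g x = x \<or> var (g x) - var x \<in> F"
    and p: "p \<in> carrier (mpoly_ring X)"
  shows "p \<in> Idl\<^bsub>mpoly_ring X\<^esub> (ideal_of X M \<union> F) \<longleftrightarrow> push (push g) p \<in> ideal_of X (push g ` M)"
proof
  interpret cring "mpoly_ring X :: ('x, 'k) mpoly ring" by (rule cring_mpoly_ring)
  let ?P = "ideal_of X M :: ('x, 'k) mpoly set"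
  let ?Q = "ideal_of X (push g ` M) :: ('x, 'k) mpoly set"
  let ?N = "Idl\<^bsub>mpoly_ring X\<^esub> (?P \<union> F)"
  have gM: "Poly_Mapping.keys s \<subseteq> X" if "s \<in> push g ` M" for s
    using that M g by (fastforce simp: keys_push_nat)
  have P: "ideal ?P (mpoly_ring X)" using M by (rule ideal_ideal_of)
  have Q: "ideal ?Q (mpoly_ring X)" using gM by (rule ideal_ideal_of)
  have Mc: "mono ` M \<subseteq> carrier (mpoly_ring X :: ('x, 'k) mpoly ring)"
    "mono ` push g ` M \<subseteq> carrier (mpoly_ring X :: ('x, 'k) mpoly ring)"
    using M gM by (auto simp: mono_def single_carrier)
  have MP: "mono ` M \<subseteq> ?P" and MQ: "mono ` push g ` M \<subseteq> ?Q"
    unfolding ideal_of_def using Mc by (auto intro!: genideal_self)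
  have PF: "?P \<union> F \<subseteq> carrier (mpoly_ring X)"
    using mpoly_ideal_closed(6)[OF P] F(1) by blast
  have N: "ideal ?N (mpoly_ring X)" by (rule genideal_ideal[OF PF])
  {
    assume pN: "p \<in> ?N"
    \<comment> \<open>The preimage of the target ideal under the substitution. It is an ideal
      containing all generators of \<open>?N\<close>.\<close>
    let ?K = "{p \<in> carrier (mpoly_ring X). push (push g) p \<in> ?Q}"
    have K: "ideal ?K (mpoly_ring X)"
      by (rule ideal_mpoly_ringI)
        (auto simp: push_add push_push_mult intro!: mpoly_carrier_closed mpoly_ideal_closed[OF Q]
          push_carrier[OF _ g])
    have "mono ` M \<subseteq> ?K" using Mc MQ by (auto simp: mono_def)
    then have "?P \<subseteq> ?K" unfolding ideal_of_def[of X M] by (rule genideal_minimal[OF K])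
    moreover have "F \<subseteq> ?K" using F mpoly_ideal_closed(1)[OF Q] by auto
    ultimately have "?N \<subseteq> ?K" by (intro genideal_minimal[OF K]) blast
    with pN show "push (push g) p \<in> ?Q" by blast
  next
    assume pQ: "push (push g) p \<in> ?Q"
    have sub: "?P \<union> F \<subseteq> ?N" by (rule genideal_self[OF PF])
    have diff: "push (push g) q - q \<in> ?N" if "q \<in> carrier (mpoly_ring X)" for q
    proof (rule push_diff_mem_ideal[OF N g _ that])
      show "var (g x) - var x \<in> ?N" if "x \<in> X" for x
        using vars[OF that] sub mpoly_ideal_closed(1)[OF N] by auto
    qed
    have "mono (push g s) \<in> ?N" if s: "s \<in> M" for s
    proof -
      have "mono s \<in> ?N" using MP sub s by blast
      moreover have "push (push g) (mono s) - mono s \<in> ?N" using diff Mc(1) s by blast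
      ultimately have "(push (push g) (mono s) - mono s) + mono s \<in> ?N"
        by (intro mpoly_ideal_closed(2)[OF N])
      then show ?thesis by (simp add: mono_def)
    qed
    then have "?Q \<subseteq> ?N" unfolding ideal_of_def[of X "push g ` M"] by (intro genideal_minimal[OF N]) blast
    then have "push (push g) p \<in> ?N" using pQ by blast
    then have "push (push g) p - (push (push g) p - p) \<in> ?N"
      using diff[OF p] by (rule mpoly_ideal_closed(5)[OF N])
    then show "p \<in> ?N" by simp
  }
qed

section \<open>The ideal of a spanning tree\<close>

text \<open>A subset of \<open>V\<close> with \<open>d\<close> elements omits exactly one
  vertex.\<close>

lemma sqfree_power_eq:
  assumes "finite V" and "card V = Suc d"
  shows "(sqfree_power V d :: ('x, 'k::comm_ring_1) mpoly set) =
    ideal_of V ((\<lambda>u. sqfree_mon (V - {u})) ` V)"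
proof -
  have "{s. Poly_Mapping.keys s \<subseteq> V \<and> sqfree s \<and> mon_deg s = d} = (\<lambda>u. sqfree_mon (V - {u})) ` V"
  proof (intro equalityI subsetI)
    fix s assume s: "s \<in> {s. Poly_Mapping.keys s \<subseteq> V \<and> sqfree s \<and> mon_deg s = d}"
    let ?K = "Poly_Mapping.keys s"
    have eq: "s = sqfree_mon ?K" using s by (intro sqfree_eq_sqfree_mon) simp
    have "card ?K = d" using s mon_deg_sqfree_mon[of ?K] eq by simp
    then have "card (V - ?K) = 1" using s assms by (simp add: card_Diff_subset)
    then obtain u where "V - ?K = {u}" by (rule card_1_singletonE)
    then have "?K = V - {u}" "u \<in> V" using s by auto
    then show "s \<in> (\<lambda>u. sqfree_mon (V - {u})) ` V" using eq by auto
  next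
    fix s assume "s \<in> (\<lambda>u. sqfree_mon (V - {u})) ` V"
    then obtain u where "u \<in> V" "s = sqfree_mon (V - {u})" by blast
    then show "s \<in> {s. Poly_Mapping.keys s \<subseteq> V \<and> sqfree s \<and> mon_deg s = d}"
      using assms by (auto simp: keys_sqfree_mon sqfree_sqfree_mon mon_deg_sqfree_mon)
  qed
  then show ?thesis by (simp add: sqfree_power_def)
qed

text \<open>Replaces a copy by the fixed copy exactly when their difference is in \<open>F\<close>,
  which gives canonical representatives modulo these differences.\<close>

definition merge ::
    "('v \<Rightarrow> 'c) \<Rightarrow> ('v \<times> 'c, 'k::comm_ring_1) mpoly set \<Rightarrow> 'v \<times> 'c \<Rightarrow> 'v \<times> 'c" where
  "merge c F = (\<lambda>(i, j). if var (i, c i) - var (i, j) \<in> F then (i, c i) else (i, j))"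

lemma fst_merge [simp]: "fst (merge c F x) = fst x"
  by (simp add: merge_def split: prod.splits)

lemma merge_fixed [simp]: "merge c F (i, c i) = (i, c i)"
  by (simp add: merge_def)

lemma merge_image_subset:
  assumes "\<And>i. i \<in> V \<Longrightarrow> c i \<in> C i"
  shows "merge c F ` Sigma V C \<subseteq> Sigma V C"
  using assms by (auto simp: merge_def split: if_splits)

context labelled_tree
begin

abbreviation Vars :: "(nat \<times> nat) set" where
  "Vars \<equiv> Sigma V (copies L v w)"

abbreviation gen :: "nat \<Rightarrow> (nat \<times> nat) monomial" where
  "gen \<equiv> tree_gen L v w T"

lemma gen_eq: "gen u = sqfree_mon (lab u)"
  by (simp add: tree_gen_def sqfree_mon_def)

lemma lab_Vars: "lab u \<subseteq> Vars"
proof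
  fix l assume "l \<in> lab u"
  moreover obtain x i where "l = (x, i)" by (cases l)
  ultimately show "l \<in> Vars" using lab_V by (auto simp: copies_def mem_lab)
qed

lemma keys_gen: "u \<in> V \<Longrightarrow> Poly_Mapping.keys (gen u) = lab u"
  by (simp add: gen_eq keys_sqfree_mon finite_lab)

lemma keys_gens: "s \<in> gen ` V \<Longrightarrow> Poly_Mapping.keys s \<subseteq> Vars"
  using keys_gen lab_Vars by (metis imageE)

text \<open>The lcm has support \<open>lab x \<union> lab y\<close>, so its degree exceeds the
  common degree \<open>card L\<close> by \<open>card (lab x - lab y)\<close>.\<close>

lemma linear_relation_gen:
  assumes "x \<in> V" "y \<in> V"
  shows "linear_relation (gen x) (gen y) \<longleftrightarrow> {x, y} \<in> T"
proof -
  have "mon_deg (mon_lcm (gen x) (gen y)) = card (lab y \<union> (lab x - lab y))"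
    using assms by (simp add: gen_eq mon_lcm_sqfree_mon mon_deg_sqfree_mon finite_lab Un_commute)
  also have "\<dots> = card (lab y) + card (lab x - lab y)"
    using assms by (intro card_Un_disjoint) (auto simp: finite_lab)
  finally have lcm: "mon_deg (mon_lcm (gen x) (gen y)) = card L + card (lab x - lab y)"
    using assms by (simp add: card_lab)
  have deg: "mon_deg (gen u) = card L" if "u \<in> V" for u
    using that by (simp add: gen_eq mon_deg_sqfree_mon finite_lab card_lab)
  have "gen x \<noteq> gen y" if "card (lab x - lab y) = 1"
  proof
    assume "gen x = gen y"
    then have "lab x = lab y" using keys_gen assms by metis
    with that show False by simp
  qed
  then show ?thesis
    unfolding linear_relation_def lcm edge_iff_card_lab_diff[OF assms] using deg assms by auto
qed

lemma copies_nonempty: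
  assumes "L \<noteq> {}" and "i \<in> V"
  shows "copies L v w i \<noteq> {}"
proof -
  have "card L \<noteq> 0" using assms(1) fin by simp
  then have "card (V - {i}) \<noteq> 0" using card_V fin assms(2) by simp
  then have "V - {i} \<noteq> {}" by fastforce
  then obtain u where "u \<in> V" "i \<noteq> u" by blast
  then show ?thesis using ex_lab[of u i] lab_Vars[of u] assms(2) by fastforce
qed

lemma subst_ideal_gens:
  assumes "L \<noteq> {}"
  shows "subst_vars (\<lambda>(i, j). var i) ` ideal_of Vars (gen ` V) =
    (sqfree_power V (card L) :: (nat, 'k::comm_ring_1) mpoly set)"
proof -
  have subst: "subst_vars (\<lambda>(i, j). var i) p = push (push fst) p" for p :: "(nat \<times> nat, 'k) mpoly"
    unfolding subst_vars_var[symmetric] by (simp add: case_prod_beta')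
  have P: "p \<in> ideal_of Vars (gen ` V) \<longleftrightarrow> p \<in> carrier (mpoly_ring Vars) \<and>
      (\<forall>s\<in>Poly_Mapping.keys p. \<exists>u\<in>V. lab u \<subseteq> Poly_Mapping.keys s)" for p :: "(nat \<times> nat, 'k) mpoly"
    unfolding gen_eq[abs_def] by (rule mem_ideal_of_sqfree_mon) (simp add: finite_lab lab_Vars)
  have D: "q \<in> sqfree_power V (card L) \<longleftrightarrow> q \<in> carrier (mpoly_ring V) \<and>
      (\<forall>s\<in>Poly_Mapping.keys q. \<exists>u\<in>V. V - {u} \<subseteq> Poly_Mapping.keys s)" for q :: "(nat, 'k) mpoly"
    unfolding sqfree_power_eq[OF fin(1) card_V]
    by (rule mem_ideal_of_sqfree_mon) (simp add: fin)
  show ?thesis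
  proof (intro equalityI subsetI)
    fix q :: "(nat, 'k) mpoly" assume "q \<in> subst_vars (\<lambda>(i, j). var i) ` ideal_of Vars (gen ` V)"
    then obtain p :: "(nat \<times> nat, 'k) mpoly"
      where p: "p \<in> ideal_of Vars (gen ` V)" and q: "q = push (push fst) p"
      using subst by auto
    have "q \<in> carrier (mpoly_ring V)"
      unfolding q using p P by (intro push_carrier[of p Vars]) auto
    moreover have "\<exists>u\<in>V. V - {u} \<subseteq> Poly_Mapping.keys s" if s: "s \<in> Poly_Mapping.keys q" for s
    proof -
      obtain t where t: "t \<in> Poly_Mapping.keys p" "s = push fst t"
        using s keys_push[of "push fst" p] unfolding q by blast
      then obtain u where u: "u \<in> V" "lab u \<subseteq> Poly_Mapping.keys t" using p P by blast
      have "V - {u} = fst ` lab u" using bij_fst_lab[OF u(1)] by (simp add: bij_betw_def)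
      then show ?thesis using u unfolding t(2) keys_push_nat by blast
    qed
    ultimately show "q \<in> sqfree_power V (card L)" unfolding D by blast
  next
    fix q :: "(nat, 'k) mpoly" assume q: "q \<in> sqfree_power V (card L)"
    have "\<exists>t. push fst t = s \<and> Poly_Mapping.keys t \<subseteq> Vars \<and> (\<exists>u\<in>V. lab u \<subseteq> Poly_Mapping.keys t)"
      if s: "s \<in> Poly_Mapping.keys q" for s
    proof -
      obtain u where u: "u \<in> V" "V - {u} \<subseteq> Poly_Mapping.keys s" using q s D by blast
      have sV: "Poly_Mapping.keys s \<subseteq> V" using q s D by (auto simp: carrier_mpoly_ring)
      \<comment> \<open>For \<open>x \<noteq> u\<close> the copy must be the one in
        \<open>lab u\<close>; for \<open>x = u\<close> any copy will do.\<close>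
      have "\<exists>i. (x, i) \<in> Vars \<and> (x \<noteq> u \<longrightarrow> (x, i) \<in> lab u)" if "x \<in> V" for x
      proof (cases "x = u")
        case True
        then show ?thesis using copies_nonempty[OF assms that] that by auto
      next
        case False
        then show ?thesis using ex_lab[OF u(1) that] lab_Vars by blast
      qed
      then obtain h where h: "\<And>x. x \<in> V \<Longrightarrow> (x, h x) \<in> Vars"
        "\<And>x. x \<in> V \<Longrightarrow> x \<noteq> u \<Longrightarrow> (x, h x) \<in> lab u" by metis
      let ?t = "push (\<lambda>x. (x, h x)) s"
      have "push fst ?t = s" unfolding push_push by (rule push_ident) simp
      moreover have "Poly_Mapping.keys ?t \<subseteq> Vars" using h(1) sV by (auto simp: keys_push_nat)
      moreover have "lab u \<subseteq> Poly_Mapping.keys ?t"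
      proof
        fix l assume l: "l \<in> lab u"
        obtain x i where xi: "l = (x, i)" by (cases l)
        have x: "x \<in> V" "x \<noteq> u" using l xi lab_V lab_neq_self[OF u(1)] by auto
        then have "i = h x" using h(2) l xi lab_fst_unique[OF u(1)] by blast
        then show "l \<in> Poly_Mapping.keys ?t" using x u xi by (auto simp: keys_push_nat)
      qed
      ultimately show ?thesis using u(1) by blast
    qed
    then obtain f where f: "\<And>s. s \<in> Poly_Mapping.keys q \<Longrightarrow> push fst (f s) = s \<and>
        Poly_Mapping.keys (f s) \<subseteq> Vars \<and> (\<exists>u\<in>V. lab u \<subseteq> Poly_Mapping.keys (f s))" by metis
    \<comment> \<open>Lift \<open>q\<close> term by term with its coefficients. Since
      \<open>push fst\<close> undoes \<open>f\<close> on the monomials of \<open>q\<close>, the lift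
      maps back to \<open>q\<close>.\<close>
    have "push f q \<in> ideal_of Vars (gen ` V)"
      unfolding P carrier_mpoly_ring using f keys_push[of f q] by blast
    moreover have "push (push fst) (push f q) = q"
      unfolding push_push by (rule push_ident) (simp add: f)
    ultimately show "q \<in> subst_vars (\<lambda>(i, j). var i) ` ideal_of Vars (gen ` V)"
      using subst by (metis imageI)
  qed
qed

text \<open>This supplies the hypothesis \<open>meet\<close> of \<open>var_diff_mult_regular\<close>
  after merging. Unless both \<open>a\<close> and \<open>b\<close> are hit, \<open>u\<close> or
  \<open>u'\<close> itself is a witness.\<close>

lemma merged_labels_exchange:
  assumes g: "\<And>x. fst (g x) = fst x" and ab: "fst a = fst b" "a \<noteq> b"
    and u: "u \<in> V" "u' \<in> V" "g ` lab u \<subseteq> insert a K" "g ` lab u' \<subseteq> insert b K"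
  shows "\<exists>z\<in>V. g ` lab z \<subseteq> K"
proof (cases "a \<in> g ` lab u \<and> b \<in> g ` lab u'")
  case True
  then obtain l l' where l: "l \<in> lab u" "a = g l" and l': "l' \<in> lab u'" "b = g l'" by blast
  obtain z \<alpha> \<beta> where z: "l = (z, \<alpha>)" "l' = (z, \<beta>)"
    using g ab(1) l(2) l'(2) by (metis prod.collapse)
  have "\<alpha> \<noteq> \<beta>" using z l l' ab(2) by blast
  with u l l' z have sub: "lab z \<subseteq> lab u \<union> lab u'" by (intro lab_subset_union) auto
  have zV: "z \<in> V" using l z lab_V by blast
  have "g k \<in> K" if k: "k \<in> lab z" for k
  proof -
    \<comment> \<open>No label of \<open>z\<close> is a copy of the variable of \<open>z\<close>,
      and \<open>g\<close> preserves the variable, so \<open>g k\<close> is neither \<open>a\<close>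
      nor \<open>b\<close>.\<close>
    have "fst k \<noteq> z" using k lab_neq_self[OF zV] by (metis prod.collapse)
    then have "fst (g k) \<noteq> fst a" "fst (g k) \<noteq> fst b" using g ab(1) l(2) z(1) by auto
    then show ?thesis using sub k u(3,4) by blast
  qed
  with zV show ?thesis by blast
next
  case False
  then show ?thesis using u by blast
qed

lemma regular_sequence_copies:
  fixes ds :: "(nat \<times> nat, 'k::comm_ring_1) mpoly list"
  assumes L: "L \<noteq> {}" and c: "\<And>i. i \<in> V \<Longrightarrow> c i \<in> copies L v w i" and "distinct ds"
    and ds: "set ds = {var (i, c i) - var (i, j) | i j. i \<in> V \<and> j \<in> copies L v w i \<and> j \<noteq> c i}"
  shows "regular_sequence (mpoly_ring Vars Quot ideal_of Vars (gen ` V))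
    (map ((+>\<^bsub>mpoly_ring Vars\<^esub>) (ideal_of Vars (gen ` V))) ds)"
proof -
  let ?R = "mpoly_ring Vars :: (nat \<times> nat, 'k) mpoly ring"
  let ?P = "ideal_of Vars (gen ` V) :: (nat \<times> nat, 'k) mpoly set"
  interpret cring ?R by (rule cring_mpoly_ring)
  have dsc: "set ds \<subseteq> carrier ?R"
  proof
    fix d assume "d \<in> set ds"
    then obtain i j where "d = var (i, c i) - var (i, j)" "(i, c i) \<in> Vars" "(i, j) \<in> Vars"
      using ds c by auto
    then have "d = var (i, c i) + - var (i, j)" "var (i, c i) \<in> carrier ?R" "var (i, j) \<in> carrier ?R"
      by (simp_all only: diff_conv_add_uminus var_carrier)
    then show "d \<in> carrier ?R" by (simp only: mpoly_carrier_closed)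
  qed
  have mem: "p \<in> Idl\<^bsub>?R\<^esub> (?P \<union> F) \<longleftrightarrow> push (push (merge c F)) p \<in> carrier ?R \<and>
      (\<forall>s\<in>Poly_Mapping.keys (push (push (merge c F)) p). \<exists>u\<in>V. merge c F ` lab u \<subseteq> Poly_Mapping.keys s)"
    if F: "F \<subseteq> set ds" and p: "p \<in> carrier ?R" for F p
  proof -
    let ?g = "merge c F"
    have gV: "?g ` Vars \<subseteq> Vars" using c by (rule merge_image_subset)
    have "p \<in> Idl\<^bsub>?R\<^esub> (?P \<union> F) \<longleftrightarrow> push (push ?g) p \<in> ideal_of Vars (push ?g ` gen ` V)"
    proof (rule mem_Idl_union_iff_push[OF keys_gens gV _ _ _ p])
      show "F \<subseteq> carrier ?R" using F dsc by blast
      show "push (push ?g) f = 0" if fF: "f \<in> F" for f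
      proof -
        obtain i j where f: "f = var (i, c i) - var (i, j)" using fF F ds by blast
        then have "?g (i, j) = (i, c i)" using fF by (simp add: merge_def)
        then show ?thesis by (simp add: f push_diff push_var)
      qed
      show "?g x = x \<or> var (?g x) - var x \<in> F" for x
        by (auto simp: merge_def split: prod.splits)
    qed
    moreover have "push ?g ` gen ` V = (\<lambda>u. sqfree_mon (?g ` lab u)) ` V"
    proof -
      \<comment> \<open>Labels of \<open>u\<close> belong to pairwise different variables, so
        merging keeps the generator square-free.\<close>
      have "inj_on ?g (lab u)" if "u \<in> V" for u
        using lab_fst_unique[OF that] by (intro inj_onI) (metis fst_merge prod.collapse)
      then show ?thesis by (simp add: image_image gen_eq push_sqfree_mon cong: image_cong_simp)
    qed
    moreover have "finite (?g ` lab u) \<and> ?g ` lab u \<subseteq> Vars" if "u \<in> V" for u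
      using that finite_lab lab_Vars gV by blast
    ultimately show ?thesis using mem_ideal_of_sqfree_mon[of V "\<lambda>u. ?g ` lab u" Vars] by simp
  qed
  show ?thesis
  proof (rule regular_sequence_quotI[OF ideal_ideal_of[OF keys_gens] dsc])
    \<comment> \<open>Properness: the only monomial of 1 has empty support, which contains no
      nonempty label set.\<close>
    have "Poly_Mapping.keys (1 :: (nat \<times> nat, 'k) mpoly) = {0}" by simp
    moreover have "lab u \<noteq> {}" if "u \<in> V" for u
      using card_lab[OF that] L fin by auto
    ultimately show "\<one>\<^bsub>?R\<^esub> \<notin> Idl\<^bsub>?R\<^esub> (?P \<union> set ds)"
      using mem[OF subset_refl, of 1] by (auto simp: push_one)
  next
    fix k p
    let ?F = "set (take k ds)"
    let ?g = "merge c ?F"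
    assume k: "k < length ds" and p: "p \<in> carrier ?R"
      and dp: "ds ! k \<otimes>\<^bsub>?R\<^esub> p \<in> Idl\<^bsub>?R\<^esub> (?P \<union> ?F)"
    have F: "?F \<subseteq> set ds" by (rule set_take_subset)
    have dk: "ds ! k \<in> set ds" using k by simp
    then obtain i j where d: "ds ! k = var (i, c i) - var (i, j)" and ij: "j \<noteq> c i"
      unfolding ds by blast
    \<comment> \<open>Distinctness of the list ensures that the copy \<open>(i, j)\<close> has not
      been merged yet, so the substitution keeps the next difference intact.\<close>
    have "ds ! k \<notin> ?F"
      using \<open>distinct ds\<close> k by (auto simp: in_set_conv_nth nth_eq_iff_index_eq)
    then have gj: "?g (i, j) = (i, j)" using d by (simp add: merge_def)
    let ?q = "push (push ?g) p"
    let ?U = "{s :: (nat \<times> nat) monomial. \<exists>u\<in>V. ?g ` lab u \<subseteq> Poly_Mapping.keys s}"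
    have "push (push ?g) (ds ! k * p) = (var (i, c i) - var (i, j)) * ?q"
      by (simp add: push_push_mult d push_diff push_var gj)
    moreover have dpc: "ds ! k * p \<in> carrier ?R"
      using mpoly_carrier_closed(3) dk dsc p by blast
    ultimately have U: "Poly_Mapping.keys ((var (i, c i) - var (i, j)) * ?q) \<subseteq> ?U"
      using dp mem[OF F dpc] by auto
    have "Poly_Mapping.keys ?q \<subseteq> ?U"
    proof (rule var_diff_mult_regular[OF _ _ _ U])
      show "t + s \<in> ?U" if "s \<in> ?U" for s t
        using that unfolding keys_add_nat mem_Collect_eq by blast
      show "(i, c i) \<noteq> (i, j)" using ij by simp
      fix s :: "(nat \<times> nat) monomial"
      let ?K = "Poly_Mapping.keys s"
      assume "Poly_Mapping.single (i, c i) 1 + s \<in> ?U" "Poly_Mapping.single (i, j) 1 + s \<in> ?U"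
      then obtain u u' where "u \<in> V" "u' \<in> V" "?g ` lab u \<subseteq> insert (i, c i) ?K"
        "?g ` lab u' \<subseteq> insert (i, j) ?K" by (auto simp: keys_add_nat)
      then show "s \<in> ?U"
        using merged_labels_exchange[of ?g "(i, c i)" "(i, j)" u u' ?K] ij by simp
    qed
    moreover have "?q \<in> carrier ?R"
      using c by (intro push_carrier[OF p] merge_image_subset)
    ultimately show "p \<in> Idl\<^bsub>?R\<^esub> (?P \<union> ?F)" using mem[OF F p] by blast
  qed
qed

lemma polarization_gens:
  assumes "L \<noteq> {}"
  shows "polarization V (copies L v w) (ideal_of Vars (gen ` V))
    (sqfree_power V (card L) :: (nat, 'k::field) mpoly set)"
  unfolding polarization_def
proof (intro conjI ballI allI impI; (elim conjE)?)
  show "finite V" by (rule fin)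
  fix i assume "i \<in> V"
  show "finite (copies L v w i)" using fin by (simp add: copies_def)
  show "copies L v w i \<noteq> {}" using copies_nonempty assms \<open>i \<in> V\<close> by blast
next
  show "monomial_ideal V (sqfree_power V (card L) :: (nat, 'k) mpoly set)"
    unfolding monomial_ideal_def sqfree_power_def
    by (rule exI, rule conjI[OF _ refl]) simp
  show "sqfree_monomial_ideal Vars (ideal_of Vars (gen ` V) :: (nat \<times> nat, 'k) mpoly set)"
    unfolding sqfree_monomial_ideal_def
  proof (intro exI conjI ballI)
    show "Poly_Mapping.keys s \<subseteq> Vars" if "s \<in> gen ` V" for s using that by (rule keys_gens)
    show "sqfree s" if "s \<in> gen ` V" for s
      using that by (auto simp: gen_eq sqfree_sqfree_mon finite_lab)
  qed (rule refl)
  show "subst_vars (\<lambda>(i, j). var i) ` ideal_of Vars (gen ` V) =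
    (sqfree_power V (card L) :: (nat, 'k) mpoly set)" by (rule subst_ideal_gens[OF assms])
next
  fix c and ds :: "(nat \<times> nat, 'k) mpoly list"
  assume "\<forall>i\<in>V. c i \<in> copies L v w i" "distinct ds"
    "set ds = {var (i, c i) - var (i, j) | i j. i \<in> V \<and> j \<in> copies L v w i \<and> j \<noteq> c i}"
  then show "regular_sequence (mpoly_ring Vars Quot ideal_of Vars (gen ` V))
    (map ((+>\<^bsub>mpoly_ring Vars\<^esub>) (ideal_of Vars (gen ` V))) ds)"
    using assms by (intro regular_sequence_copies) auto
qed

end

theorem proposition4p3:
  fixes n :: nat
    and T :: "nat set set"
    and v w :: "nat \<Rightarrow> nat"
    and D :: "(nat, 'k::field) mpoly set"
    and m :: "nat \<Rightarrow> (nat \<times> nat) monomial"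
    and C :: "nat \<Rightarrow> nat set"
    and P :: "(nat \<times> nat, 'k) mpoly set"
  assumes "n \<ge> 2"
    and "spanning_tree {1..n} T"
    and "bij_betw (\<lambda>i. {v i, w i}) {1..n - 1} T"
    and D_def: "D = sqfree_power {1..n} (n - 1)"
    and m_def: "m = tree_gen {1..n - 1} v w T"
    and C_def: "C = copies {1..n - 1} v w"
    and P_def: "P = ideal_of (Sigma {1..n} C) (m ` {1..n})"
  shows "polarization {1..n} C P D \<and>
    (\<forall>i\<in>{1..n}. \<forall>j\<in>{1..n}. linear_relation (m i) (m j) \<longleftrightarrow> {i, j} \<in> T)"
proof -
  \<comment> \<open>\<open>card_V\<close> holds because \<open>n \<ge> 2\<close> makes the
    subtraction in \<open>n - 1\<close> exact.\<close>
  interpret labelled_tree "{1..n}" "{1..n - 1}" v w T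
    using assms(1-3) by unfold_locales auto
  have "{1..n - 1} \<noteq> {}" using assms(1) by simp
  from polarization_gens[OF this, where 'k = 'k] linear_relation_gen show ?thesis
    unfolding D_def P_def C_def m_def by simp
qed

end
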